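(* Let $S$ be a set of variables of $R_{\mathbf{a}}$ and let $Z_S=S\cap\{z_1,\ldots,z_n\}=\{z_{i_1},\ldots,z_{i_k}\}$ with $i_1<\cdots<i_k$ (set $i_{k+1}=i_1$). Then $S$ is a facet of $\mathcal{T}_{\mathbf{a}}$ if and only if $Z_S\neq\emptyset$ and, for every $1\le t\le k$, the sequence of multi-edges traversed clockwise from $i_t$ to $i_{t+1}$ (namely the multi-edges with indices $i_t,i_t+1,\ldots,i_{t+1}-1$ mod $n$; all $n$ multi-edges if $k=1$) is of one of the following two forms: (1) the first multi-edge is of type A, it is followed by zero or more multi-edges each of type A or type B, then by exactly one multi-edge of type C in which every edge contributes either its $\overleftarrow{y}$-variable or its $t$-variable, and all remaining (zero or more) multi-edges are of type B; (2) the first multi-edge is of type C in which every edge contributes either its $z$-variable (the edge variable $z^{(i)}_j$) or its $t$-variable, and all remaining (zero or more) multi-edges are of type B.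
   Context: Fix $n\ge3$ and $\mathbf{a}=(a_1,\ldots,a_n)$ with $a_i\ge1$. $C_{\mathbf{a}}$ is the graph on $[n]$ (indices mod $n$) whose edges are, for each $i$, the $a_i$ parallel edges $e^{(i)}_1,\ldots,e^{(i)}_{a_i}$ between $i$ and $i+1$ (the $i$-th multi-edge). Let $R_{\mathbf{a}}$ be the polynomial ring over a field in variables $z_k$ ($k\in[n]$) and, for each edge $e=e^{(i)}_j$, $z^{(i)}_j,t^{(i)}_j,\overrightarrow{y}^{(i)}_j,\overleftarrow{y}^{(i)}_j$, corresponding to lattice points $\mathbf{e}_k,\mathbf{e}_e,\mathbf{e}_i+\mathbf{e}_{i+1}-\mathbf{e}_e,\mathbf{e}_i-\mathbf{e}_{i+1}+\mathbf{e}_e,-\mathbf{e}_i+\mathbf{e}_{i+1}+\mathbf{e}_e$ in $\mathbb{R}^{[n]\cup E}$. Put $V(e^{(i)}_j)=\{\overrightarrow{y}^{(i)}_j,\overleftarrow{y}^{(i)}_j,t^{(i)}_j,z^{(i)}_j\}$; an edge $e$ "contributes" the variables in $S\cap V(e)$. Let $<$ be the lexicographic order induced by $\overrightarrow{y}^{(1)}_1>\cdots>\overrightarrow{y}^{(1)}_{a_1}>\overrightarrow{y}^{(2)}_1>\cdots>\overrightarrow{y}^{(n)}_{a_n}>\overleftarrow{y}^{(n)}_{a_n}>\cdots>\overleftarrow{y}^{(n)}_1>\overleftarrow{y}^{(n-1)}_{a_{n-1}}>\cdots>\overleftarrow{y}^{(1)}_1>z^{(1)}_1>\cdots>z^{(n)}_{a_n}>t^{(1)}_1>\cdots>t^{(n)}_{a_n}>z_1>\cdots>z_n$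 (within each block, upper index first, then lower index, in the directions shown). For an edge directed $a\to b$ write $y(a\to b)$ for its $y$-variable corresponding to $\mathbf{e}_a-\mathbf{e}_b+\mathbf{e}_e$. Let $B$ consist of: fundamental binomials for each edge $e$ between $i,i+1$: $\overrightarrow{y}\,\overleftarrow{y}-z_e^2$, $\overrightarrow{y}t-z_i^2$, $\overleftarrow{y}t-z_{i+1}^2$, $\overrightarrow{y}z_{i+1}-z_iz_e$, $\overleftarrow{y}z_i-z_{i+1}z_e$, $tz_e-z_iz_{i+1}$; zig-zag binomials $z_v\prod_{f\in E_1}y(f)\prod_{f\in E_2}z_f-z_u\prod_{f\in E_2}y(f)\prod_{f\in E_1}z_f$ for every path from $u$ to $v$ of length $\ge2$ and partition of its edges into $P_1\ni$ (edge at $u$), $P_2\ni$ (edge at $v$), $E_1$ = $P_1$ directed towards $v$, $E_2$ = $P_2$ directed towards $u$; cyclic binomials $\prod_{f\in E_1}y(f)\prod_{f\in E_2}z_f-\prod_{f\in E_2}y(f)\prod_{f\in E_1}z_f$ for every cycle with fixed orientation and partition $C_1\cup C_2$ of its edges (one part possibly empty), $E_1$ = $C_1$ directed along, $E_2$ = $C_2$ directed against the orientation. A facet of $\mathcal{T}_{\mathbf{a}}$ is a set $S$ of $n+a_1+\cdots+a_n$ variables containing (i.e. including all variables of) the $<$-leading monomial of no binomial in $B$. For a set $S$ of variables and $i\in[n]$, the $i$-th multi-edge is of type A if there is $j$ with $S\cap V(e^{(i)}_j)=\{\overrightarrow{y}^{(i)}_j,z^{(i)}_j\}$ and each other edge $e^{(i)}_k$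 contributes exactly one variable, lying in $\{t^{(i)}_k,z^{(i)}_k\}$ if $k<j$ and in $\{t^{(i)}_k,\overrightarrow{y}^{(i)}_k\}$ if $k>j$; it is of type B if there is $j$ with $S\cap V(e^{(i)}_j)=\{\overleftarrow{y}^{(i)}_j,z^{(i)}_j\}$ and each other edge contributes exactly one variable, lying in $\{t^{(i)}_k,\overleftarrow{y}^{(i)}_k\}$ if $k<j$ and in $\{t^{(i)}_k,z^{(i)}_k\}$ if $k>j$; it is of type C if every edge $e^{(i)}_j$ contributes exactly one variable. *)

theory Defs
  imports "HOL-Library.Poly_Mapping" "Graph_Theory.Arc_Walk"
begin

section \<open>The multigraph\<close>

text \<open>The edge \<open>(i, j)\<close> is the \<open>j\<close>-th of the \<open>a i\<close> parallel edges between \<open>i\<close> and \<open>i + 1\<close>;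
  vertices are \<open>1, \<dots>, n\<close>, and the successor of \<open>n\<close> is \<open>1\<close>.\<close>

type_synonym edge = "nat \<times> nat"

definition nxt :: "nat \<Rightarrow> nat \<Rightarrow> nat" where
  "nxt n i = i mod n + 1"

definition edges :: "nat \<Rightarrow> (nat \<Rightarrow> nat) \<Rightarrow> edge set" where
  "edges n a = (SIGMA i:{1..n}. {1..a i})"

text \<open>The undirected multigraph is represented by the digraph that has two mutually opposite
  arcs for every edge: \<open>(e, True)\<close> is \<open>e\<close> directed from \<open>i\<close> to \<open>i + 1\<close>, and \<open>(e, False)\<close> is \<open>e\<close>
  directed from \<open>i + 1\<close> to \<open>i\<close>.\<close>

type_synonym arc = "edge \<times> bool"

definition cyc_graph :: "nat \<Rightarrow> (nat \<Rightarrow> nat) \<Rightarrow> (nat, arc) pre_digraph" where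
  "cyc_graph n a =
    \<lparr> verts = {1..n},
      arcs = edges n a \<times> UNIV,
      tail = (\<lambda>(e, d). if d then fst e else nxt n (fst e)),
      head = (\<lambda>(e, d). if d then nxt n (fst e) else fst e) \<rparr>"

definition opp :: "arc \<Rightarrow> arc" where
  "opp f = (fst f, \<not> snd f)"

section \<open>Variables and polynomials\<close>

text \<open>\<open>YR\<close> and \<open>YL\<close> are the variables written with a right and a left arrow over \<open>y\<close>; \<open>ZE\<close> is the
  \<open>z\<close>-variable of an edge, \<open>ZV\<close> that of a vertex.\<close>

datatype var = YR edge | YL edge | ZE edge | T edge | ZV nat

definition edge_vars :: "edge \<Rightarrow> var set" where
  "edge_vars e = {YR e, YL e, T e, ZE e}"

definition vars :: "nat \<Rightarrow> (nat \<Rightarrow> nat) \<Rightarrow> var set" where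
  "vars n a = ZV ` {1..n} \<union> (\<Union>e\<in>edges n a. edge_vars e)"

text \<open>Polynomials over a field \<open>'k\<close>, as finitely supported functions on monomials.  The polynomials
  that occur below only involve the variables in \<open>vars n a\<close>.\<close>

type_synonym monomial = "var \<Rightarrow>\<^sub>0 nat"
type_synonym 'k mpoly = "monomial \<Rightarrow>\<^sub>0 'k"

definition X :: "var \<Rightarrow> 'k::field mpoly" where
  "X v = Poly_Mapping.single (Poly_Mapping.single v 1) 1"

text \<open>The variable \<open>y(u \<rightarrow> v)\<close> of an edge \<open>e\<close> directed from \<open>u\<close> to \<open>v\<close>, which corresponds to the
  lattice point \<open>e\<^sub>u - e\<^sub>v + e\<^sub>e\<close>.\<close>

definition y_var :: "arc \<Rightarrow> var" where
  "y_var f = (if snd f then YR (fst f) else YL (fst f))"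

section \<open>The lexicographic order\<close>

definition edge_before :: "edge \<Rightarrow> edge \<Rightarrow> bool" where
  "edge_before e f \<longleftrightarrow> fst e < fst f \<or> fst e = fst f \<and> snd e < snd f"

fun var_block :: "var \<Rightarrow> nat" where
  "var_block (YR e) = 0"
| "var_block (YL e) = 1"
| "var_block (ZE e) = 2"
| "var_block (T e) = 3"
| "var_block (ZV i) = 4"

text \<open>Within the block of the \<open>YL\<close> the order is reversed.\<close>

fun greater_in_block :: "var \<Rightarrow> var \<Rightarrow> bool" where
  "greater_in_block (YR e) (YR f) = edge_before e f"
| "greater_in_block (YL e) (YL f) = edge_before f e"
| "greater_in_block (ZE e) (ZE f) = edge_before e f"
| "greater_in_block (T e) (T f) = edge_before e f"
| "greater_in_block (ZV i) (ZV j) = (i < j)"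
| "greater_in_block _ _ = False"

definition var_greater :: "var \<Rightarrow> var \<Rightarrow> bool" where
  "var_greater v w \<longleftrightarrow> var_block v < var_block w \<or> greater_in_block v w"

definition lex_less :: "monomial \<Rightarrow> monomial \<Rightarrow> bool" where
  "lex_less m m' \<longleftrightarrow>
    (\<exists>v. Poly_Mapping.lookup m v < Poly_Mapping.lookup m' v \<and>
      (\<forall>w. var_greater w v \<longrightarrow> Poly_Mapping.lookup m w = Poly_Mapping.lookup m' w))"

definition is_leading_monomial :: "'k::field mpoly \<Rightarrow> monomial \<Rightarrow> bool" where
  "is_leading_monomial p m \<longleftrightarrow>
    m \<in> Poly_Mapping.keys p \<and> (\<forall>m'\<in>Poly_Mapping.keys p. m' \<noteq> m \<longrightarrow> lex_less m' m)"

section \<open>The binomials\<close>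

definition fundamental_binomials :: "nat \<Rightarrow> (nat \<Rightarrow> nat) \<Rightarrow> 'k::field mpoly set" where
  "fundamental_binomials n a =
    (\<Union>e\<in>edges n a. let i = fst e; i' = nxt n i in
      {X (YR e) * X (YL e) - X (ZE e) ^ 2,
       X (YR e) * X (T e) - X (ZV i) ^ 2,
       X (YL e) * X (T e) - X (ZV i') ^ 2,
       X (YR e) * X (ZV i') - X (ZV i) * X (ZE e),
       X (YL e) * X (ZV i) - X (ZV i') * X (ZE e),
       X (T e) * X (ZE e) - X (ZV i) * X (ZV i')})"

text \<open>In the next two definitions \<open>p\<close> lists the arcs of the path or cycle in the direction of
  traversal, so \<open>E\<^sub>1\<close> is \<open>P1\<close> itself, and \<open>E\<^sub>2\<close> consists of the opposites of the arcs in \<open>P2\<close>.\<close>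

definition zigzag_binomials :: "nat \<Rightarrow> (nat \<Rightarrow> nat) \<Rightarrow> 'k::field mpoly set" where
  "zigzag_binomials n a =
    {X (ZV v) * (\<Prod>f\<in>P1. X (y_var f)) * (\<Prod>f\<in>P2. X (ZE (fst f)))
       - X (ZV u) * (\<Prod>f\<in>P2. X (y_var (opp f))) * (\<Prod>f\<in>P1. X (ZE (fst f))) | u v p P1 P2.
     pre_digraph.apath (cyc_graph n a) u p v \<and> length p \<ge> 2 \<and>
     P1 \<union> P2 = set p \<and> P1 \<inter> P2 = {} \<and> hd p \<in> P1 \<and> last p \<in> P2}"

text \<open>The distinctness condition excludes going back and forth along the same edge, which is a
  cycle of the digraph but not of the multigraph.  Two parallel edges do form a cycle.\<close>

definition cyclic_binomials :: "nat \<Rightarrow> (nat \<Rightarrow> nat) \<Rightarrow> 'k::field mpoly set" where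
  "cyclic_binomials n a =
    {(\<Prod>f\<in>C1. X (y_var f)) * (\<Prod>f\<in>C2. X (ZE (fst f)))
       - (\<Prod>f\<in>C2. X (y_var (opp f))) * (\<Prod>f\<in>C1. X (ZE (fst f))) | p C1 C2.
     pre_digraph.cycle (cyc_graph n a) p \<and> distinct (map fst p) \<and>
     C1 \<union> C2 = set p \<and> C1 \<inter> C2 = {}}"

definition binomials :: "nat \<Rightarrow> (nat \<Rightarrow> nat) \<Rightarrow> 'k::field mpoly set" where
  "binomials n a = fundamental_binomials n a \<union> zigzag_binomials n a \<union> cyclic_binomials n a"

section \<open>Facets\<close>

definition facet :: "'k::field mpoly set \<Rightarrow> nat \<Rightarrow> (nat \<Rightarrow> nat) \<Rightarrow> var set \<Rightarrow> bool" where
  "facet B n a S \<longleftrightarrow>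
    S \<subseteq> vars n a \<and> card S = n + (\<Sum>i=1..n. a i) \<and>
    (\<forall>p\<in>B. \<forall>m. is_leading_monomial p m \<longrightarrow> \<not> Poly_Mapping.keys m \<subseteq> S)"

section \<open>Types of multi-edges\<close>

definition contributes_one_of :: "var set \<Rightarrow> edge \<Rightarrow> var set \<Rightarrow> bool" where
  "contributes_one_of S e W \<longleftrightarrow> (\<exists>v\<in>W. S \<inter> edge_vars e = {v})"

definition type_A :: "(nat \<Rightarrow> nat) \<Rightarrow> var set \<Rightarrow> nat \<Rightarrow> bool" where
  "type_A a S i \<longleftrightarrow>
    (\<exists>j\<in>{1..a i}. S \<inter> edge_vars (i, j) = {YR (i, j), ZE (i, j)} \<and>
      (\<forall>k\<in>{1..a i}.
        (k < j \<longrightarrow> contributes_one_of S (i, k) {T (i, k), ZE (i, k)}) \<and>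
        (k > j \<longrightarrow> contributes_one_of S (i, k) {T (i, k), YR (i, k)})))"

definition type_B :: "(nat \<Rightarrow> nat) \<Rightarrow> var set \<Rightarrow> nat \<Rightarrow> bool" where
  "type_B a S i \<longleftrightarrow>
    (\<exists>j\<in>{1..a i}. S \<inter> edge_vars (i, j) = {YL (i, j), ZE (i, j)} \<and>
      (\<forall>k\<in>{1..a i}.
        (k < j \<longrightarrow> contributes_one_of S (i, k) {T (i, k), YL (i, k)}) \<and>
        (k > j \<longrightarrow> contributes_one_of S (i, k) {T (i, k), ZE (i, k)})))"

definition type_C :: "(nat \<Rightarrow> nat) \<Rightarrow> var set \<Rightarrow> nat \<Rightarrow> bool" where
  "type_C a S i \<longleftrightarrow> (\<forall>j\<in>{1..a i}. contributes_one_of S (i, j) (edge_vars (i, j)))"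

section \<open>Sequences of multi-edges\<close>

text \<open>The indices of the multi-edges traversed clockwise from \<open>i\<close> to \<open>j\<close>; all \<open>n\<close> of them, starting
  with \<open>i\<close>, if \<open>i = j\<close>.\<close>

definition clockwise :: "nat \<Rightarrow> nat \<Rightarrow> nat \<Rightarrow> nat list" where
  "clockwise n i j = (if i < j then [i..<j] else [i..<Suc n] @ [1..<j])"

definition form1 :: "(nat \<Rightarrow> nat) \<Rightarrow> var set \<Rightarrow> nat list \<Rightarrow> bool" where
  "form1 a S L \<longleftrightarrow>
    (\<exists>i As c Bs. L = i # As @ c # Bs \<and>
      type_A a S i \<and>
      (\<forall>x\<in>set As. type_A a S x \<or> type_B a S x) \<and>
      type_C a S c \<and> (\<forall>j\<in>{1..a c}. contributes_one_of S (c, j) {YL (c, j), T (c, j)}) \<and>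
      (\<forall>x\<in>set Bs. type_B a S x))"

definition form2 :: "(nat \<Rightarrow> nat) \<Rightarrow> var set \<Rightarrow> nat list \<Rightarrow> bool" where
  "form2 a S L \<longleftrightarrow>
    (\<exists>c Bs. L = c # Bs \<and>
      type_C a S c \<and> (\<forall>j\<in>{1..a c}. contributes_one_of S (c, j) {ZE (c, j), T (c, j)}) \<and>
      (\<forall>x\<in>set Bs. type_B a S x))"

end

theory Submission
  imports Defs
begin

text \<open>Call a multi-edge paired if one of its edges contributes two variables.  The fundamental
  binomials and the cyclic binomials of pairs of parallel edges force such an edge to contribute its
  \<open>ZE\<close> and one of its \<open>y\<close>-variables, and to be the only one in its multi-edge; so multi-edge \<open>i\<close>
  contributes at most \<open>a i\<close> variables, or \<open>a i + 1\<close> if it is paired, with equality exactly for the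
  types C and A or B.  A zigzag binomial (or a cyclic one, if there is only one vertex variable)
  forbids that all multi-edges between two consecutive vertex variables are paired.  Comparing with
  the required cardinality, exactly one multi-edge between any two consecutive vertex variables is
  unpaired, and all bounds are attained.  The remaining constraints all say that between a multi-edge
  containing some \<open>YR\<close> and a later vertex variable there is a multi-edge without \<open>YR\<close> and \<open>ZE\<close>;
  conversely this property prevents the leading monomial of every zigzag from lying in \<open>S\<close>.\<close>

subsection \<open>Leading monomials of binomials\<close>

text \<open>Leading monomials stay manageable because every \<open>YR\<close> precedes all other
  variables. On a path or a full cycle all arcs point the same way, so one of the two monomials
  contains a \<open>YR\<close> and the other none, and it leads whatever its other factors are; the
  only exception is a full cycle without any \<open>YR\<close>, where \<open>YL\<close> competes
  with \<open>ZE\<close>. The many partitions then collapse: \<open>S\<close> itself decides whether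
  an edge enters through its \<open>YR\<close> or its \<open>ZE\<close>, and a multi-edge blocks all
  of these monomials when it offers neither. The order inside a block matters only for two parallel
  edges; there the two \<open>y\<close>-blocks run in opposite directions, which makes types A and B
  mirror images. The count has no slack. With k vertex variables, the edges must contribute n - k
  variables more than there are edges. The k segments have total length n, and one of length m
  yields an excess of at most m - 1.\<close>

lemma var_greater_irrefl: "\<not> var_greater v v"
  by (cases v) (auto simp: var_greater_def edge_before_def)

lemma var_greater_trans: "var_greater u v \<Longrightarrow> var_greater v w \<Longrightarrow> var_greater u w"
  unfolding var_greater_def by (cases u; cases v; cases w) (auto simp: edge_before_def)

lemma var_greater_total: "v \<noteq> w \<Longrightarrow> var_greater v w \<or> var_greater w v"
  unfolding var_greater_def by (cases v; cases w) (auto simp: edge_before_def prod_eq_iff)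

lemma lex_less_asym: "lex_less m m' \<Longrightarrow> \<not> lex_less m' m"
  unfolding lex_less_def
  by (metis less_irrefl less_not_sym var_greater_total)

lemma finite_has_greatest_var:
  assumes "finite V" "V \<noteq> {}"
  shows "\<exists>v\<in>V. \<forall>w\<in>V. w \<noteq> v \<longrightarrow> var_greater v w"
  using assms
proof (induction V rule: finite_ne_induct)
  case (insert x F)
  then obtain v where v: "v \<in> F" "\<forall>w\<in>F. w \<noteq> v \<longrightarrow> var_greater v w"
    by blast
  show ?case
  proof (cases "var_greater x v")
    case True
    with v show ?thesis
      by (metis insertE insertI1 var_greater_trans)
  next
    case False
    with v insert.hyps show ?thesis
      by (metis insertE insertI2 var_greater_total)
  qed
qed auto

text \<open>The greatest variable \<open>u\<close> of \<open>m'\<close> is at least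
  \<open>v\<close>, hence exceeds every variable of \<open>m\<close>. Above \<open>u\<close> both
  exponents are 0, and at \<open>u\<close> only that of \<open>m'\<close> is positive, so supports
  alone decide.\<close>

lemma lex_lessI:
  assumes "v \<in> Poly_Mapping.keys m'" "\<And>w. w \<in> Poly_Mapping.keys m \<Longrightarrow> var_greater v w"
  shows "lex_less m m'"
proof -
  obtain u where u: "u \<in> Poly_Mapping.keys m'"
    "\<forall>w\<in>Poly_Mapping.keys m'. w \<noteq> u \<longrightarrow> var_greater u w"
    using finite_has_greatest_var[OF finite_keys] assms(1) by blast
  have gt: "var_greater u w" if "w \<in> Poly_Mapping.keys m" for w
    using assms u that by (metis var_greater_trans)
  show ?thesis
    unfolding lex_less_def
  proof (intro exI conjI allI impI)
    have "u \<notin> Poly_Mapping.keys m"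
      using gt var_greater_irrefl by blast
    with u show "Poly_Mapping.lookup m u < Poly_Mapping.lookup m' u"
      by (simp add: in_keys_iff)
    show "Poly_Mapping.lookup m w = Poly_Mapping.lookup m' w" if "var_greater w u" for w
    proof -
      have "w \<notin> Poly_Mapping.keys m" "w \<notin> Poly_Mapping.keys m'"
        using gt u that by (metis var_greater_trans var_greater_irrefl)+
      then show ?thesis by (simp add: in_keys_iff)
    qed
  qed
qed

text \<open>Exponents are forgotten on purpose: containment in \<open>S\<close> sees only the
  support, and all comparisons are settled by \<open>lex_lessI\<close>.\<close>

definition monomial_on :: "'k::field mpoly \<Rightarrow> var set \<Rightarrow> bool" where
  "monomial_on p V \<longleftrightarrow> (\<exists>m. p = Poly_Mapping.single m 1 \<and> Poly_Mapping.keys m = V)"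

definition avoids :: "var set \<Rightarrow> 'k::field mpoly \<Rightarrow> bool" where
  "avoids S p \<longleftrightarrow> (\<forall>m. is_leading_monomial p m \<longrightarrow> \<not> Poly_Mapping.keys m \<subseteq> S)"

lemma keys_add_nat: "Poly_Mapping.keys (m + m' :: 'a \<Rightarrow>\<^sub>0 nat) = Poly_Mapping.keys m \<union> Poly_Mapping.keys m'"
  by (auto simp: in_keys_iff lookup_add)

lemma monomial_on_X: "monomial_on (X v) {v}"
  unfolding monomial_on_def X_def by (intro exI[of _ "Poly_Mapping.single v 1"]) simp

lemma monomial_on_one: "monomial_on 1 {}"
  unfolding monomial_on_def by (intro exI[of _ 0]) simp

lemma monomial_on_mult:
  assumes "monomial_on p V" "monomial_on q W"
  shows "monomial_on (p * q) (V \<union> W)"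
proof -
  obtain m m' where "p = Poly_Mapping.single m 1" "Poly_Mapping.keys m = V"
    "q = Poly_Mapping.single m' 1" "Poly_Mapping.keys m' = W"
    using assms by (auto simp: monomial_on_def)
  then show ?thesis
    unfolding monomial_on_def
    by (intro exI[of _ "m + m'"]) (simp add: mult_single keys_add_nat)
qed

lemma monomial_on_X_square: "monomial_on (X v ^ 2) {v}"
  using monomial_on_mult[OF monomial_on_X monomial_on_X, of v v] by (simp add: power2_eq_square)

lemma monomial_on_prod: "finite A \<Longrightarrow> monomial_on (\<Prod>f\<in>A. X (h f)) (h ` A)"
proof (induction A rule: finite_induct)
  case (insert f A)
  then show ?case
    using monomial_on_mult[OF monomial_on_X[of "h f"] insert.IH] by simp
qed (simp add: monomial_on_one)

text \<open>The strict comparison also separates the two monomials, so nothing cancels; the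
  coefficients 1 and -1 are both nonzero, so either sign of the binomial has the same leading
  monomial.\<close>

lemma avoids_diff:
  assumes p: "monomial_on p V" and q: "monomial_on q W"
    and v: "v \<in> V" "\<And>w. w \<in> W \<Longrightarrow> var_greater v w"
  shows "avoids S (p - q) \<longleftrightarrow> \<not> V \<subseteq> S" and "avoids S (q - p) \<longleftrightarrow> \<not> V \<subseteq> S"
proof -
  obtain m where m: "p = Poly_Mapping.single m 1" "Poly_Mapping.keys m = V"
    using p by (auto simp: monomial_on_def)
  obtain m' where m': "q = Poly_Mapping.single m' 1" "Poly_Mapping.keys m' = W"
    using q by (auto simp: monomial_on_def)
  have less: "lex_less m' m"
    using lex_lessI m m' v by blast
  then have ne: "m \<noteq> m'"
    using lex_less_asym by blast
  have keys: "Poly_Mapping.keys (p - q) = {m, m'}" "Poly_Mapping.keys (q - p) = {m, m'}"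
    using ne unfolding m m'
    by (auto simp: in_keys_iff lookup_minus lookup_single when_def split: if_splits)
  have lead: "is_leading_monomial r k \<longleftrightarrow> k = m" if "Poly_Mapping.keys r = {m, m'}" for r :: "'a mpoly" and k
    using less lex_less_asym[OF less] ne that by (auto simp: is_leading_monomial_def)
  show "avoids S (p - q) \<longleftrightarrow> \<not> V \<subseteq> S" "avoids S (q - p) \<longleftrightarrow> \<not> V \<subseteq> S"
    using lead[OF keys(1)] lead[OF keys(2)] m(2) by (simp_all add: avoids_def)
qed

subsection \<open>Walks in the cycle with parallel edges\<close>

lemma nxt_in: "n \<ge> 1 \<Longrightarrow> nxt n i \<in> {1..n}"
  using mod_less_divisor[of n i] by (auto simp: nxt_def Suc_le_eq)

lemma nxt_inj:
  assumes "i \<in> {1..n}" "j \<in> {1..n}" "nxt n i = nxt n j"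
  shows "i = j"
proof -
  have "i mod n = (if i = n then 0 else i)" "j mod n = (if j = n then 0 else j)"
    using assms(1,2) by auto
  then show ?thesis
    using assms by (auto simp: nxt_def split: if_splits)
qed

lemma nxt_neq: "n \<ge> 2 \<Longrightarrow> i \<in> {1..n} \<Longrightarrow> nxt n i \<noteq> i"
  by (cases "i = n") (auto simp: nxt_def)

lemma funpow_nxt:
  assumes "u \<in> {1..n}"
  shows "(nxt n ^^ k) u = (u - 1 + k) mod n + 1"
proof (induction k)
  case 0
  then show ?case using assms by (auto simp: less_eq_Suc_le)
next
  case (Suc k)
  then show ?case by (simp add: nxt_def mod_Suc_eq)
qed

lemma funpow_nxt_in: "u \<in> {1..n} \<Longrightarrow> (nxt n ^^ k) u \<in> {1..n}"
  using nxt_in[of n] by (cases k) auto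

lemma funpow_nxt_n: "u \<in> {1..n} \<Longrightarrow> (nxt n ^^ n) u = u"
  using mod_add_self2[of "u - 1" n] by (subst funpow_nxt) (auto simp: less_eq_Suc_le)

lemma funpow_nxt_surj:
  assumes "u \<in> {1..n}" "x \<in> {1..n}"
  shows "\<exists>k<n. (nxt n ^^ k) u = x"
proof (cases "u \<le> x")
  case True
  then show ?thesis
    using assms by (intro exI[of _ "x - u"]) (auto simp: funpow_nxt)
next
  case False
  then have "(u - 1 + (n + x - u)) mod n = (x - 1 + n) mod n"
    using assms by (intro arg_cong[where f = "\<lambda>k. k mod n"]) auto
  also have "\<dots> = x - 1"
    using assms mod_add_self2[of "x - 1" n] by auto
  finally have "(nxt n ^^ (n + x - u)) u = x"
    using assms by (auto simp: funpow_nxt)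
  then show ?thesis
    using assms False by (intro exI[of _ "n + x - u"]) auto
qed

text \<open>By \<open>funpow_nxt_surj\<close> the \<open>n\<close> exponents reach all
  \<open>n\<close> vertices, and a surjection between finite sets of equal size is
  injective.\<close>

lemma funpow_nxt_eq_iff:
  assumes "u \<in> {1..n}" "k < n" "l < n"
  shows "(nxt n ^^ k) u = (nxt n ^^ l) u \<longleftrightarrow> k = l"
proof
  have "inj_on (\<lambda>k. (nxt n ^^ k) u) {..<n}"
  proof (rule eq_card_imp_inj_on)
    have "(\<lambda>k. (nxt n ^^ k) u) ` {..<n} = {1..n}"
    proof (intro equalityI subsetI)
      fix x assume "x \<in> {1..n}"
      with funpow_nxt_surj[OF assms(1)] show "x \<in> (\<lambda>k. (nxt n ^^ k) u) ` {..<n}"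
        by (metis imageI lessThan_iff)
    qed (use funpow_nxt_in[OF assms(1)] in blast)
    then show "card ((\<lambda>k. (nxt n ^^ k) u) ` {..<n}) = card {..<n}"
      by simp
  qed simp
  then show "(nxt n ^^ k) u = (nxt n ^^ l) u \<Longrightarrow> k = l"
    using assms by (auto dest: inj_onD)
qed auto

lemma funpow_nxt_return:
  assumes "u \<in> {1..n}" "0 < k" "(nxt n ^^ k) u = u"
  shows "n \<le> k"
  using funpow_nxt_eq_iff[OF assms(1), of k 0] assms by (cases "n = 0") (auto simp: not_less[symmetric])

text \<open>\<open>g\<close> selects one parallel edge in each multi-edge. These walks supply the
  paths and full cycles whose binomials turn avoidance into conditions on \<open>S\<close>.\<close>

definition forward :: "nat \<Rightarrow> (nat \<Rightarrow> nat) \<Rightarrow> nat \<Rightarrow> nat \<Rightarrow> arc list" where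
  "forward n g w l = map (\<lambda>k. (((nxt n ^^ k) w, g ((nxt n ^^ k) w)), True)) [0..<l]"

lemma cyc_graph_simps:
  "verts (cyc_graph n a) = {1..n}"
  "arcs (cyc_graph n a) = edges n a \<times> UNIV"
  "tail (cyc_graph n a) (e, d) = (if d then fst e else nxt n (fst e))"
  "head (cyc_graph n a) (e, d) = (if d then nxt n (fst e) else fst e)"
  by (simp_all add: cyc_graph_def)

lemma cas_append_ex:
  "pre_digraph.cas G u (p @ q) v \<longleftrightarrow> (\<exists>w. pre_digraph.cas G u p w \<and> pre_digraph.cas G w q v)"
  by (induction p arbitrary: u) (simp_all add: pre_digraph.cas.simps)

lemma cas_end_in_verts: "pre_digraph.cas G u p v \<Longrightarrow> v \<in> set (pre_digraph.awalk_verts G u p)"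
  by (induction p arbitrary: u) (simp_all add: pre_digraph.cas.simps pre_digraph.awalk_verts.simps)

lemma cas_forward:
  "pre_digraph.cas (cyc_graph n a) w (forward n g w l) ((nxt n ^^ l) w)"
  by (induction l)
    (simp_all add: forward_def pre_digraph.cas.simps cas_append_ex cyc_graph_simps)

lemma awalk_verts_forward:
  "pre_digraph.awalk_verts (cyc_graph n a) w (forward n g w l) = map (\<lambda>k. (nxt n ^^ k) w) [0..<Suc l]"
proof (cases l)
  case (Suc m)
  have "map (tail (cyc_graph n a)) (forward n g w l) = map (\<lambda>k. (nxt n ^^ k) w) [0..<l]"
    by (simp add: forward_def cyc_graph_simps)
  moreover have "last (forward n g w l) = (((nxt n ^^ m) w, g ((nxt n ^^ m) w)), True)"
    by (simp add: forward_def Suc)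
  moreover have "forward n g w l \<noteq> []"
    by (simp add: forward_def Suc)
  ultimately show ?thesis
    by (simp add: pre_digraph.awalk_verts_conv cyc_graph_simps Suc)
qed (simp add: forward_def pre_digraph.awalk_verts.simps)

lemma forward_arcs:
  assumes "w \<in> {1..n}" "\<And>i. i \<in> {1..n} \<Longrightarrow> g i \<in> {1..a i}"
  shows "set (forward n g w l) \<subseteq> edges n a \<times> UNIV"
proof -
  have "g ((nxt n ^^ k) w) \<in> {1..a ((nxt n ^^ k) w)}" "(nxt n ^^ k) w \<in> {1..n}" for k
    using assms funpow_nxt_in by blast+
  then show ?thesis
    by (force simp: forward_def edges_def)
qed

lemma apath_forward:
  assumes "w \<in> {1..n}" "\<And>i. i \<in> {1..n} \<Longrightarrow> g i \<in> {1..a i}" "l < n"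
  shows "pre_digraph.apath (cyc_graph n a) w (forward n g w l) ((nxt n ^^ l) w)"
  unfolding pre_digraph.apath_def pre_digraph.awalk_def
proof (intro conjI)
  show "distinct (pre_digraph.awalk_verts (cyc_graph n a) w (forward n g w l))"
    using assms(1,3)
    by (auto simp: awalk_verts_forward distinct_map inj_on_def funpow_nxt_eq_iff simp del: upt_Suc)
qed (use assms forward_arcs[OF assms(1,2)] in \<open>simp_all add: cas_forward cyc_graph_simps\<close>)

lemma cycle_forward:
  assumes "w \<in> {1..n}" "\<And>i. i \<in> {1..n} \<Longrightarrow> g i \<in> {1..a i}"
  shows "pre_digraph.cycle (cyc_graph n a) (forward n g w n)"
proof -
  \<comment> \<open>A cycle has distinct vertices after the first. Dropping the start
    \<open>w\<close> leaves the \<open>n\<close> iterates that begin at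
    \<open>nxt n w\<close>.\<close>
  have "map (\<lambda>k. (nxt n ^^ k) w) [1..<Suc n] = map (\<lambda>k. (nxt n ^^ k) (nxt n w)) [0..<n]"
    by (simp add: map_Suc_upt[symmetric] funpow_swap1 del: upt_Suc)
  moreover have "distinct \<dots>"
    using nxt_in[of n w] assms(1) by (auto simp: distinct_map inj_on_def funpow_nxt_eq_iff)
  ultimately have "distinct (tl (pre_digraph.awalk_verts (cyc_graph n a) w (forward n g w n)))"
    by (simp add: awalk_verts_forward map_tl[symmetric] del: upt_Suc)
  then show ?thesis
    unfolding pre_digraph.cycle_def pre_digraph.awalk_def
    using assms(1) cas_forward[of n a w g n] forward_arcs[OF assms, where l = n]
    by (intro exI[of _ w]) (auto simp: cyc_graph_simps funpow_nxt_n, simp add: forward_def)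
qed

section \<open>Directions of walks and the classification of cycles\<close>

lemma cas_all_forward:
  assumes "pre_digraph.cas (cyc_graph n a) u p v" "\<forall>f\<in>set p. snd f"
  shows "map (fst \<circ> fst) p = map (\<lambda>k. (nxt n ^^ k) u) [0..<length p] \<and> v = (nxt n ^^ length p) u"
  using assms
proof (induction p arbitrary: u)
  case (Cons f p)
  obtain e where f: "f = (e, True)"
    using Cons.prems(2) by (cases f) auto
  have "map (fst \<circ> fst) p = map (\<lambda>k. (nxt n ^^ k) (nxt n u)) [0..<length p] \<and>
    v = (nxt n ^^ length p) (nxt n u)"
    using Cons by (intro Cons.IH) (auto simp: f pre_digraph.cas.simps cyc_graph_simps)
  moreover have "fst e = u"
    using Cons.prems(1) by (simp add: f pre_digraph.cas.simps cyc_graph_simps)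
  moreover have "map (\<lambda>k. (nxt n ^^ k) u) [0..<Suc (length p)] =
      u # map (\<lambda>k. (nxt n ^^ k) (nxt n u)) [0..<length p]"
    by (simp add: upt_conv_Cons map_Suc_upt[symmetric] funpow_swap1 del: upt_Suc)
  ultimately show ?case
    by (simp add: f funpow_swap1 o_def del: upt_Suc)
qed (simp add: pre_digraph.cas.simps)

lemma cas_reverse:
  "pre_digraph.cas (cyc_graph n a) u p v \<Longrightarrow>
    pre_digraph.cas (cyc_graph n a) v (rev (map opp p)) u"
  by (induction p arbitrary: u)
    (auto simp: pre_digraph.cas.simps cas_append_ex cyc_graph_simps opp_def)

text \<open>Two successive arcs of opposite direction lie in the same multi-edge, because
  \<open>nxt\<close> is injective; the second one therefore leads back to the vertex before the
  first.\<close>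

lemma distinct_walk_direction:
  assumes "pre_digraph.cas (cyc_graph n a) u p v" "set p \<subseteq> arcs (cyc_graph n a)"
    "distinct (pre_digraph.awalk_verts (cyc_graph n a) u p)" "f \<in> set p" "f' \<in> set p"
  shows "snd f = snd f'"
proof -
  have "\<forall>f\<in>set p. snd f = snd (hd p)"
    using assms(1-3)
  proof (induction p arbitrary: u)
    case (Cons f p)
    show ?case
    proof (cases p)
      case (Cons g q)
      obtain e d e' d' where fg: "f = (e, d)" "g = (e', d')"
        by (cases f; cases g)
      have "d = d'"
        using Cons.prems nxt_inj[of "fst e" n "fst e'"]
        by (cases q)
          (auto simp: Cons fg pre_digraph.cas.simps pre_digraph.awalk_verts.simps cyc_graph_simps
            edges_def split: if_splits)
      moreover have "\<forall>f\<in>set p. snd f = snd (hd p)"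
        using Cons.prems by (intro Cons.IH)
          (auto simp: pre_digraph.cas.simps pre_digraph.awalk_verts.simps)
      ultimately show ?thesis
        by (simp add: Cons fg)
    qed simp
  qed simp
  with assms(4,5) show ?thesis
    by metis
qed

lemma forward_walk_nth:
  assumes "pre_digraph.awalk (cyc_graph n a) u p v" "\<forall>f\<in>set p. snd f" "k < length p"
  obtains j where "p ! k = (((nxt n ^^ k) u, j), True)" "j \<in> {1..a ((nxt n ^^ k) u)}"
proof -
  have "map (fst \<circ> fst) p ! k = map (\<lambda>k. (nxt n ^^ k) u) [0..<length p] ! k"
    using assms cas_all_forward[of n a u p v] by (simp add: pre_digraph.awalk_def)
  then have fst: "fst (fst (p ! k)) = (nxt n ^^ k) u"
    using assms(3) by simp
  have "p ! k \<in> set p"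
    using assms(3) by simp
  with assms fst have "p ! k \<in> edges n a \<times> UNIV" "snd (p ! k)"
    by (auto simp: pre_digraph.awalk_def cyc_graph_simps)
  with fst that show ?thesis
    by (cases "p ! k") (auto simp: edges_def)
qed

text \<open>Without its first arc the cycle is a walk with distinct vertices, hence of one
  direction. Either this is the direction of the first arc and the cycle winds around, or the cycle
  turns back at once and closes after two arcs.\<close>

lemma cycle_cases:
  assumes n: "n \<ge> 3" and cyc: "pre_digraph.cycle (cyc_graph n a) p" and dist: "distinct (map fst p)"
  obtains (parallel) i j k d where "i \<in> {1..n}" "j \<in> {1..a i}" "k \<in> {1..a i}" "j \<noteq> k"
      "p = [((i, j), d), ((i, k), \<not> d)]"
  | (full) d where "\<forall>f\<in>set p. snd f = d" "set p \<subseteq> arcs (cyc_graph n a)"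
      "\<forall>i\<in>{1..n}. \<exists>j\<in>{1..a i}. ((i, j), d) \<in> set p"
proof -
  obtain u where walk: "pre_digraph.awalk (cyc_graph n a) u p u" and
    tl: "distinct (tl (pre_digraph.awalk_verts (cyc_graph n a) u p))" and ne: "p \<noteq> []"
    using cyc by (auto simp: pre_digraph.cycle_def)
  obtain e d q where p: "p = (e, d) # q"
    using ne by (cases p) auto
  note [simp] = pre_digraph.cas.simps pre_digraph.awalk_verts.simps cyc_graph_simps
  have u: "u \<in> {1..n}" and arcs: "set p \<subseteq> arcs (cyc_graph n a)" and cas: "pre_digraph.cas (cyc_graph n a) u p u"
    using walk by (auto simp: pre_digraph.awalk_def)
  have e: "fst e \<in> {1..n}" "snd e \<in> {1..a (fst e)}"
    using arcs by (auto simp: p edges_def)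
  show thesis
  proof (cases "\<exists>f\<in>set q. snd f = d")
    case True
    have dir: "\<forall>f\<in>set p. snd f = d"
    proof -
      have "pre_digraph.cas (cyc_graph n a) (if d then nxt n (fst e) else fst e) q u"
        "set q \<subseteq> arcs (cyc_graph n a)"
        "distinct (pre_digraph.awalk_verts (cyc_graph n a) (if d then nxt n (fst e) else fst e) q)"
        using cas arcs tl by (simp_all add: p)
      from distinct_walk_direction[OF this] have "\<forall>f\<in>set q. \<forall>f'\<in>set q. snd f = snd f'"
        by blast
      with True show ?thesis
        unfolding p by (metis set_ConsD snd_conv)
    qed
    have "\<forall>i\<in>{1..n}. \<exists>j\<in>{1..a i}. ((i, j), d) \<in> set p"
    proof -
      \<comment> \<open>Reversal reduces to forward arcs, where start and length determine which
        multi-edges are met.\<close>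
      define p' where "p' = (if d then p else rev (map opp p))"
      have walk': "pre_digraph.awalk (cyc_graph n a) u p' u" "\<forall>f\<in>set p'. snd f"
        using u arcs cas_reverse[OF cas] cas dir
        by (auto simp: p'_def pre_digraph.awalk_def opp_def)
      \<comment> \<open>A forward walk of positive length returns to its start only after at least
        \<open>n\<close> arcs, so it meets every multi-edge.\<close>
      have "(nxt n ^^ length p') u = u" "0 < length p'"
        using walk' cas_all_forward[of n a u p' u] ne by (simp_all add: pre_digraph.awalk_def p'_def)
      then have len: "n \<le> length p'"
        using funpow_nxt_return[OF u] by simp
      show ?thesis
      proof
        fix i assume "i \<in> {1..n}"
        then obtain k where k: "k < n" "(nxt n ^^ k) u = i"
          using funpow_nxt_surj[OF u] by blast
        then obtain j where "p' ! k = ((i, j), True)" "j \<in> {1..a i}"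
          using forward_walk_nth[OF walk', of k] len by auto
        moreover from k len have "p' ! k \<in> set p'"
          by simp
        ultimately have "((i, j), True) \<in> set p'" "j \<in> {1..a i}"
          by auto
        then show "\<exists>j\<in>{1..a i}. ((i, j), d) \<in> set p"
          using dir by (cases d) (force simp: p'_def opp_def)+
      qed
    qed
    with dir arcs full show thesis
      by blast
  next
    case False
    \<comment> \<open>The first arc is not a loop, so a second one follows; pointing the other way,
      it lies in the same multi-edge.\<close>
    obtain e' d' q' where q: "q = (e', d') # q'"
      using cas n nxt_neq[OF _ e(1)] by (cases q) (auto simp: p split: if_splits)
    have d': "d' = (\<not> d)"
      using False by (auto simp: q)
    have e': "fst e' \<in> {1..n}" "snd e' \<in> {1..a (fst e')}"
      using arcs by (auto simp: p q edges_def)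
    have fst: "fst e' = fst e"
      using cas nxt_inj e(1) e'(1) by (auto simp: p q d' split: if_splits)
    \<comment> \<open>After two arcs the walk is at \<open>u\<close> again. The vertices of
      \<open>q'\<close> are distinct but begin and end with \<open>u\<close>, so nothing is
      left.\<close>
    have "pre_digraph.cas (cyc_graph n a) u q' u"
      "distinct (pre_digraph.awalk_verts (cyc_graph n a) u q')"
      using tl cas by (auto simp: p q d' fst split: if_splits)
    then have "q' = []"
      using cas_end_in_verts[of "cyc_graph n a" _ _ u] by (cases q') auto
    then show thesis
      using parallel[of "fst e" "snd e" "snd e'" d] e e' fst dist by (auto simp: p q d' prod_eq_iff)
  qed
qed

lemma awalk_verts_cas: "pre_digraph.cas G u p v \<Longrightarrow> pre_digraph.awalk_verts G u p = u # map (head G) p"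
proof (induction p arbitrary: u)
  case (Cons f p)
  then show ?case
    by (auto simp: pre_digraph.cas.simps pre_digraph.awalk_verts.simps)
qed (simp add: pre_digraph.awalk_verts.simps)

lemma awalk_verts_reverse:
  assumes "pre_digraph.cas (cyc_graph n a) u p v"
  shows "pre_digraph.awalk_verts (cyc_graph n a) v (rev (map opp p)) =
    rev (pre_digraph.awalk_verts (cyc_graph n a) u p)"
proof (cases p)
  case (Cons f q)
  have opp: "tail (cyc_graph n a) (opp g) = head (cyc_graph n a) g"
    "head (cyc_graph n a) (opp g) = tail (cyc_graph n a) g" for g
    by (cases g; simp add: opp_def cyc_graph_simps)+
  then have "map (tail (cyc_graph n a)) (rev (map opp p)) = rev (map (head (cyc_graph n a)) p)"
    by (simp add: rev_map[symmetric])
  moreover have "head (cyc_graph n a) (last (rev (map opp p))) = u"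
    using assms by (simp add: Cons opp pre_digraph.cas.simps)
  ultimately show ?thesis
    unfolding awalk_verts_cas[OF assms] by (simp add: pre_digraph.awalk_verts_conv Cons)
qed (use assms in \<open>simp add: pre_digraph.cas.simps pre_digraph.awalk_verts.simps\<close>)

subsection \<open>Sets of variables avoiding all leading monomials\<close>

text \<open>A forward path takes either \<open>YR\<close> or \<open>ZE\<close> of each edge it
  crosses into its leading monomial, so no such monomial with support in \<open>S\<close> crosses a
  bare multi-edge.\<close>

definition bare :: "(nat \<Rightarrow> nat) \<Rightarrow> var set \<Rightarrow> nat \<Rightarrow> bool" where
  "bare a S i \<longleftrightarrow> (\<forall>j\<in>{1..a i}. YR (i, j) \<notin> S \<and> ZE (i, j) \<notin> S)"

definition has_YR :: "(nat \<Rightarrow> nat) \<Rightarrow> var set \<Rightarrow> nat \<Rightarrow> bool" where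
  "has_YR a S i \<longleftrightarrow> (\<exists>j\<in>{1..a i}. YR (i, j) \<in> S)"

definition has_YL :: "(nat \<Rightarrow> nat) \<Rightarrow> var set \<Rightarrow> nat \<Rightarrow> bool" where
  "has_YL a S i \<longleftrightarrow> (\<exists>j\<in>{1..a i}. YL (i, j) \<in> S)"

text \<open>The six forbidden pairs are the supports of the leading monomials of the fundamental
  binomials.\<close>

definition edge_free :: "nat \<Rightarrow> (nat \<Rightarrow> nat) \<Rightarrow> var set \<Rightarrow> bool" where
  "edge_free n a S \<longleftrightarrow> (\<forall>e\<in>edges n a.
    \<not> {YR e, YL e} \<subseteq> S \<and> \<not> {YR e, T e} \<subseteq> S \<and> \<not> {YL e, T e} \<subseteq> S \<and>
    \<not> {YR e, ZV (nxt n (fst e))} \<subseteq> S \<and> \<not> {YL e, ZV (fst e)} \<subseteq> S \<and> \<not> {T e, ZE e} \<subseteq> S)"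

text \<open>These come from the cycles of two parallel edges. The index comparison goes opposite
  ways for \<open>YR\<close> and \<open>YL\<close> because the block of the \<open>YL\<close> is
  ordered backwards.\<close>

definition parallel_free :: "nat \<Rightarrow> (nat \<Rightarrow> nat) \<Rightarrow> var set \<Rightarrow> bool" where
  "parallel_free n a S \<longleftrightarrow> (\<forall>i\<in>{1..n}. \<forall>j\<in>{1..a i}. \<forall>k\<in>{1..a i}.
    (j \<noteq> k \<longrightarrow> \<not> {YR (i, j), YL (i, k)} \<subseteq> S) \<and>
    (j < k \<longrightarrow> \<not> {YR (i, j), ZE (i, k)} \<subseteq> S \<and> \<not> {YL (i, k), ZE (i, j)} \<subseteq> S))"

text \<open>The zigzags along forward paths with \<open>l\<close> arcs from \<open>w\<close>: the
  first edge brings a \<open>YR\<close>, the end its vertex variable. Position 0 is left out of the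
  range of \<open>k\<close> since a multi-edge with \<open>YR\<close> is never bare.\<close>

definition chain_free :: "nat \<Rightarrow> (nat \<Rightarrow> nat) \<Rightarrow> var set \<Rightarrow> bool" where
  "chain_free n a S \<longleftrightarrow> (\<forall>w\<in>{1..n}. \<forall>l\<in>{2..<n}.
    has_YR a S w \<and> ZV ((nxt n ^^ l) w) \<in> S \<longrightarrow> (\<exists>k\<in>{0<..<l}. bare a S ((nxt n ^^ k) w)))"

text \<open>The two kinds of full cycles: those with a \<open>YR\<close> in the leading monomial,
  and those where a product of \<open>YL\<close> beats a product of \<open>ZE\<close>.\<close>

definition cycle_free :: "nat \<Rightarrow> (nat \<Rightarrow> nat) \<Rightarrow> var set \<Rightarrow> bool" where
  "cycle_free n a S \<longleftrightarrow>
    ((\<exists>i\<in>{1..n}. has_YR a S i) \<longrightarrow> (\<exists>i\<in>{1..n}. bare a S i)) \<and> (\<exists>i\<in>{1..n}. \<not> has_YL a S i)"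

section \<open>Translation of each family of binomials into a condition on \<open>S\<close>\<close>

lemma avoids_fundamental_iff:
  "(\<forall>p\<in>fundamental_binomials n a :: 'k::field mpoly set. avoids S p) \<longleftrightarrow> edge_free n a S"
proof -
  \<comment> \<open>One factor beating everything in \<open>q\<close> is enough; the other, such as
    the vertex variable in \<open>YR * ZV\<close>, may lie below variables of
    \<open>q\<close>.\<close>
  have quadratic: "avoids S (X v * X v' - q) \<longleftrightarrow> \<not> {v, v'} \<subseteq> S"
    if "monomial_on q W" "u \<in> {v, v'}" "\<And>w. w \<in> W \<Longrightarrow> var_greater u w" for u v v' W and q :: "'k mpoly"
  proof -
    have "avoids S (X v * X v' - q) \<longleftrightarrow> \<not> {v} \<union> {v'} \<subseteq> S"
      using that by (intro avoids_diff(1)[OF monomial_on_mult[OF monomial_on_X monomial_on_X] that(1), of u]) auto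
    then show ?thesis by auto
  qed
  note quadratic1 = quadratic[OF monomial_on_X_square]
    and quadratic2 = quadratic[OF monomial_on_mult[OF monomial_on_X monomial_on_X]]
  have "avoids S (X (YR e) * X (YL e) - X (ZE e) ^ 2 :: 'k mpoly) \<longleftrightarrow> \<not> {YR e, YL e} \<subseteq> S"
    "avoids S (X (YR e) * X (T e) - X (ZV i) ^ 2 :: 'k mpoly) \<longleftrightarrow> \<not> {YR e, T e} \<subseteq> S"
    for e i
    by (rule quadratic1[where u = "YR e"]; simp add: var_greater_def)+
  moreover have
    "avoids S (X (YR e) * X (ZV i') - X (ZV i) * X (ZE e) :: 'k mpoly) \<longleftrightarrow> \<not> {YR e, ZV i'} \<subseteq> S" for e i i'
    by (rule quadratic2[where u = "YR e"]; auto simp add: var_greater_def)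
  moreover have
    "avoids S (X (YL e) * X (T e) - X (ZV i) ^ 2 :: 'k mpoly) \<longleftrightarrow> \<not> {YL e, T e} \<subseteq> S" for e i
    by (rule quadratic1[where u = "YL e"]; simp add: var_greater_def)
  moreover have
    "avoids S (X (YL e) * X (ZV i') - X (ZV i) * X (ZE e) :: 'k mpoly) \<longleftrightarrow> \<not> {YL e, ZV i'} \<subseteq> S" for e i i'
    by (rule quadratic2[where u = "YL e"]; auto simp add: var_greater_def)
  moreover have
    "avoids S (X (T e) * X (ZE e) - X (ZV i) * X (ZV i') :: 'k mpoly) \<longleftrightarrow> \<not> {T e, ZE e} \<subseteq> S" for e i i'
    by (rule quadratic2[where u = "ZE e"]; auto simp add: var_greater_def)
  ultimately show ?thesis
    unfolding fundamental_binomials_def edge_free_def Let_def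
    by (simp only: UN_ball_bex_simps ball_simps simp_thms)
qed

lemma avoids_cyclic_binomial:
  fixes C1 C2 :: "arc set"
  defines "p \<equiv> (\<Prod>f\<in>C1. X (y_var f)) * (\<Prod>f\<in>C2. X (ZE (fst f)))
       - (\<Prod>f\<in>C2. X (y_var (opp f))) * (\<Prod>f\<in>C1. X (ZE (fst f))) :: 'k::field mpoly"
  defines "V \<equiv> y_var ` C1 \<union> (\<lambda>f. ZE (fst f)) ` C2"
  defines "W \<equiv> (\<lambda>f. y_var (opp f)) ` C2 \<union> (\<lambda>f. ZE (fst f)) ` C1"
  assumes "finite C1" "finite C2"
  shows "v \<in> V \<Longrightarrow> (\<And>w. w \<in> W \<Longrightarrow> var_greater v w) \<Longrightarrow> avoids S p \<longleftrightarrow> \<not> V \<subseteq> S"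
    and "w \<in> W \<Longrightarrow> (\<And>v. v \<in> V \<Longrightarrow> var_greater w v) \<Longrightarrow> avoids S p \<longleftrightarrow> \<not> W \<subseteq> S"
proof -
  have V: "monomial_on ((\<Prod>f\<in>C1. X (y_var f)) * (\<Prod>f\<in>C2. X (ZE (fst f))) :: 'k mpoly) V"
    unfolding V_def using assms by (intro monomial_on_mult monomial_on_prod)
  have W: "monomial_on ((\<Prod>f\<in>C2. X (y_var (opp f))) * (\<Prod>f\<in>C1. X (ZE (fst f))) :: 'k mpoly) W"
    unfolding W_def using assms by (intro monomial_on_mult monomial_on_prod)
  show "v \<in> V \<Longrightarrow> (\<And>w. w \<in> W \<Longrightarrow> var_greater v w) \<Longrightarrow> avoids S p \<longleftrightarrow> \<not> V \<subseteq> S"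
    "w \<in> W \<Longrightarrow> (\<And>v. v \<in> V \<Longrightarrow> var_greater w v) \<Longrightarrow> avoids S p \<longleftrightarrow> \<not> W \<subseteq> S"
    unfolding p_def using avoids_diff(1)[OF V W] avoids_diff(2)[OF W V] by blast+
qed

text \<open>With all arcs forward, the first term has the \<open>YR\<close> of \<open>P1\<close> and
  the second only \<open>YL\<close>, \<open>ZE\<close> and \<open>ZV\<close>. With all arcs
  backward, the opposites of the arcs in \<open>P2\<close> bring \<open>YR\<close> into the second
  term.\<close>

lemma avoids_zigzag_binomial:
  fixes P1 P2 :: "arc set" and u v :: nat
  defines "p \<equiv> X (ZV v) * (\<Prod>f\<in>P1. X (y_var f)) * (\<Prod>f\<in>P2. X (ZE (fst f)))
       - X (ZV u) * (\<Prod>f\<in>P2. X (y_var (opp f))) * (\<Prod>f\<in>P1. X (ZE (fst f))) :: 'k::field mpoly"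
  assumes fin: "finite P1" "finite P2"
  shows "P1 \<noteq> {} \<Longrightarrow> \<forall>f\<in>P1 \<union> P2. snd f \<Longrightarrow> avoids S p \<longleftrightarrow>
      \<not> (ZV v \<in> S \<and> (\<forall>f\<in>P1. YR (fst f) \<in> S) \<and> (\<forall>f\<in>P2. ZE (fst f) \<in> S))"
    and "P2 \<noteq> {} \<Longrightarrow> \<forall>f\<in>P1 \<union> P2. \<not> snd f \<Longrightarrow> avoids S p \<longleftrightarrow>
      \<not> (ZV u \<in> S \<and> (\<forall>f\<in>P2. YR (fst f) \<in> S) \<and> (\<forall>f\<in>P1. ZE (fst f) \<in> S))"
proof -
  have V: "monomial_on (X (ZV v) * (\<Prod>f\<in>P1. X (y_var f)) * (\<Prod>f\<in>P2. X (ZE (fst f))) :: 'k mpoly)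
    ({ZV v} \<union> y_var ` P1 \<union> (\<lambda>f. ZE (fst f)) ` P2)" (is "monomial_on _ ?V")
    using fin by (intro monomial_on_mult monomial_on_prod monomial_on_X)
  have W: "monomial_on (X (ZV u) * (\<Prod>f\<in>P2. X (y_var (opp f))) * (\<Prod>f\<in>P1. X (ZE (fst f))) :: 'k mpoly)
    ({ZV u} \<union> (\<lambda>f. y_var (opp f)) ` P2 \<union> (\<lambda>f. ZE (fst f)) ` P1)" (is "monomial_on _ ?W")
    using fin by (intro monomial_on_mult monomial_on_prod monomial_on_X)
  show "avoids S p \<longleftrightarrow> \<not> (ZV v \<in> S \<and> (\<forall>f\<in>P1. YR (fst f) \<in> S) \<and> (\<forall>f\<in>P2. ZE (fst f) \<in> S))"
    if ne: "P1 \<noteq> {}" "\<forall>f\<in>P1 \<union> P2. snd f"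
  proof -
    obtain f where f: "f \<in> P1" "snd f" using ne by blast
    have "avoids S p \<longleftrightarrow> \<not> ?V \<subseteq> S"
      unfolding p_def using f ne
      by (intro avoids_diff(1)[OF V W, of "y_var f"]) (auto simp: y_var_def opp_def var_greater_def)
    with ne show ?thesis by (auto simp: y_var_def)
  qed
  show "avoids S p \<longleftrightarrow> \<not> (ZV u \<in> S \<and> (\<forall>f\<in>P2. YR (fst f) \<in> S) \<and> (\<forall>f\<in>P1. ZE (fst f) \<in> S))"
    if ne: "P2 \<noteq> {}" "\<forall>f\<in>P1 \<union> P2. \<not> snd f"
  proof -
    obtain f where f: "f \<in> P2" "\<not> snd f" using ne by blast
    have "avoids S p \<longleftrightarrow> \<not> ?W \<subseteq> S"
      unfolding p_def using f ne
      by (intro avoids_diff(2)[OF W V, of "y_var (opp f)"]) (auto simp: y_var_def opp_def var_greater_def)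
    with ne show ?thesis by (auto simp: y_var_def opp_def)
  qed
qed

lemma apath_reverse:
  assumes "pre_digraph.apath (cyc_graph n a) u p v"
  shows "pre_digraph.apath (cyc_graph n a) v (rev (map opp p)) u"
proof -
  have cas: "pre_digraph.cas (cyc_graph n a) u p v" and u: "u \<in> {1..n}"
    and arcs: "set p \<subseteq> edges n a \<times> UNIV"
    and dist: "distinct (pre_digraph.awalk_verts (cyc_graph n a) u p)"
    using assms by (auto simp: pre_digraph.apath_def pre_digraph.awalk_def cyc_graph_simps)
  have "v \<in> {1..n}"
    using cas u arcs
  proof (induction p arbitrary: u)
    case (Cons f p)
    then show ?case
      using nxt_in[of n] by (cases f) (auto simp: pre_digraph.cas.simps cyc_graph_simps edges_def)
  qed (simp add: pre_digraph.cas.simps)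
  moreover have "set (rev (map opp p)) \<subseteq> edges n a \<times> UNIV"
    using arcs by (auto simp: opp_def)
  moreover have "pre_digraph.awalk_verts (cyc_graph n a) v (rev (map opp p)) =
      rev (pre_digraph.awalk_verts (cyc_graph n a) u p)"
    by (rule awalk_verts_reverse[OF cas])
  ultimately show ?thesis
    using cas_reverse[OF cas] dist
    by (simp add: pre_digraph.apath_def pre_digraph.awalk_def cyc_graph_simps)
qed

text \<open>One edge per multi-edge must meet all demands: it carries \<open>YR\<close> if any edge
  does, otherwise \<open>ZE\<close> if possible. In a bare multi-edge the first edge will
  do.\<close>

lemma choose_edges:
  assumes "\<And>i. i \<in> {1..n} \<Longrightarrow> a i \<ge> 1"
  obtains g where "\<And>i. i \<in> {1..n} \<Longrightarrow> g i \<in> {1..a i}"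
    "\<And>i. i \<in> {1..n} \<Longrightarrow> has_YR a S i \<Longrightarrow> YR (i, g i) \<in> S"
    "\<And>i. i \<in> {1..n} \<Longrightarrow> \<not> bare a S i \<Longrightarrow> YR (i, g i) \<in> S \<or> ZE (i, g i) \<in> S"
proof -
  have "\<forall>i\<in>{1..n}. \<exists>j. j \<in> {1..a i} \<and> (has_YR a S i \<longrightarrow> YR (i, j) \<in> S) \<and>
    (\<not> bare a S i \<longrightarrow> YR (i, j) \<in> S \<or> ZE (i, j) \<in> S)"
  proof
    fix i assume "i \<in> {1..n}"
    then have "1 \<in> {1..a i}" using assms by simp
    then show "\<exists>j. j \<in> {1..a i} \<and> (has_YR a S i \<longrightarrow> YR (i, j) \<in> S) \<and>
      (\<not> bare a S i \<longrightarrow> YR (i, j) \<in> S \<or> ZE (i, j) \<in> S)"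
      unfolding has_YR_def bare_def by metis
  qed
  then show thesis
    using that unfolding bchoice_iff by blast
qed

text \<open>The assumption \<open>edge_free\<close> forces the last arc of a violating path into
  \<open>P2\<close>, as a zigzag demands: the \<open>YR\<close> of that arc is excluded by the
  vertex variable at its end.\<close>

lemma avoids_zigzag_iff:
  assumes a: "\<And>i. i \<in> {1..n} \<Longrightarrow> a i \<ge> 1" and edge: "edge_free n a S"
  shows "(\<forall>p\<in>zigzag_binomials n a :: 'k::field mpoly set. avoids S p) \<longleftrightarrow> chain_free n a S"
proof
  assume avoid: "\<forall>p\<in>zigzag_binomials n a :: 'k mpoly set. avoids S p"
  show "chain_free n a S"
    unfolding chain_free_def
  proof (intro ballI impI, elim conjE, rule ccontr)
    fix w l assume w: "w \<in> {1..n}" and l: "l \<in> {2..<n}" and YR: "has_YR a S w"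
      and ZV: "ZV ((nxt n ^^ l) w) \<in> S" and not_bare: "\<not> (\<exists>k\<in>{0<..<l}. bare a S ((nxt n ^^ k) w))"
    obtain g where g: "\<And>i. i \<in> {1..n} \<Longrightarrow> g i \<in> {1..a i}"
      "\<And>i. i \<in> {1..n} \<Longrightarrow> has_YR a S i \<Longrightarrow> YR (i, g i) \<in> S"
      "\<And>i. i \<in> {1..n} \<Longrightarrow> \<not> bare a S i \<Longrightarrow> YR (i, g i) \<in> S \<or> ZE (i, g i) \<in> S"
      using choose_edges[of n a S] a by metis
    define p where "p = forward n g w l"
    \<comment> \<open>The violation dictates the partition: \<open>YR\<close> where \<open>S\<close>
      has it, \<open>ZE\<close> elsewhere.\<close>
    define P1 where "P1 = {f \<in> set p. YR (fst f) \<in> S}"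
    define P2 where "P2 = set p - P1"
    define v where "v = (nxt n ^^ l) w"
    have path: "pre_digraph.apath (cyc_graph n a) w p v"
      unfolding p_def v_def using apath_forward[OF w g(1)] l by simp
    have p: "length p = l" "p \<noteq> []" "\<forall>f\<in>set p. snd f"
      using l by (auto simp: p_def forward_def)
    have "hd p = ((w, g w), True)"
      using l by (simp add: p_def forward_def upt_conv_Cons)
    then have "hd p \<in> P1"
      using g(2)[OF w YR] hd_in_set[OF p(2)] by (simp add: P1_def)
    moreover have "last p \<in> P2"
    proof -
      define x where "x = (nxt n ^^ (l - 1)) w"
      have x: "x \<in> {1..n}" "v = nxt n x"
        using funpow_nxt_in[OF w, of "l - 1"] l by (cases l; auto simp: x_def v_def)+
      have "last p = ((x, g x), True)"
        using l by (simp add: p_def forward_def last_map x_def)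
      moreover have "YR (x, g x) \<notin> S"
        using edge x g(1)[OF x(1)] ZV by (auto simp: edge_free_def edges_def v_def[symmetric])
      ultimately show ?thesis
        using p(2) last_in_set[of p] by (simp add: P1_def P2_def)
    qed
    moreover have "P1 \<union> P2 = set p" "P1 \<inter> P2 = {}"
      by (auto simp: P1_def P2_def)
    ultimately have "X (ZV v) * (\<Prod>f\<in>P1. X (y_var f)) * (\<Prod>f\<in>P2. X (ZE (fst f)))
       - X (ZV w) * (\<Prod>f\<in>P2. X (y_var (opp f))) * (\<Prod>f\<in>P1. X (ZE (fst f)))
      \<in> (zigzag_binomials n a :: 'k mpoly set)"
      unfolding zigzag_binomials_def using path l p(1) by fastforce
    with avoid have "avoids S (X (ZV v) * (\<Prod>f\<in>P1. X (y_var f)) * (\<Prod>f\<in>P2. X (ZE (fst f)))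
       - X (ZV w) * (\<Prod>f\<in>P2. X (y_var (opp f))) * (\<Prod>f\<in>P1. X (ZE (fst f))) :: 'k mpoly)"
      by blast
    moreover have "P1 \<noteq> {}"
      using \<open>hd p \<in> P1\<close> by blast
    moreover have "finite P1" "finite P2" "\<forall>f\<in>P1 \<union> P2. snd f"
      using p(3) by (auto simp: P1_def P2_def)
    ultimately have "\<not> (ZV v \<in> S \<and> (\<forall>f\<in>P1. YR (fst f) \<in> S) \<and> (\<forall>f\<in>P2. ZE (fst f) \<in> S))"
      using avoids_zigzag_binomial(1)[of P1 P2] by blast
    then obtain f where f: "f \<in> set p" "YR (fst f) \<notin> S" "ZE (fst f) \<notin> S"
      using ZV by (auto simp: v_def P1_def P2_def)
    then obtain k where k: "k < l" "f = (((nxt n ^^ k) w, g ((nxt n ^^ k) w)), True)"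
      by (auto simp: p_def forward_def)
    \<comment> \<open>The first arc carries its \<open>YR\<close>, so an arc with neither variable
      lies in the range that \<open>chain_free\<close> inspects.\<close>
    then have "k > 0"
      using f(2) g(2)[OF w YR] by (cases k) auto
    then show False
      using k f(2,3) not_bare g(3)[OF funpow_nxt_in[OF w], of k] by auto
  qed
next
  assume chain: "chain_free n a S"
  have no_chain: "\<not> (ZV v \<in> S \<and> (\<forall>f\<in>P1. YR (fst f) \<in> S) \<and> (\<forall>f\<in>P2. ZE (fst f) \<in> S))"
    if path: "pre_digraph.apath (cyc_graph n a) u p v" and dir: "\<forall>f\<in>set p. snd f" and
      len: "length p \<ge> 2" and P: "P1 \<union> P2 = set p" "hd p \<in> P1" for u p v and P1 P2 :: "arc set"
  proof
    assume S: "ZV v \<in> S \<and> (\<forall>f\<in>P1. YR (fst f) \<in> S) \<and> (\<forall>f\<in>P2. ZE (fst f) \<in> S)"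
    have walk: "pre_digraph.awalk (cyc_graph n a) u p v" and u: "u \<in> {1..n}"
      using path by (auto simp: pre_digraph.apath_def pre_digraph.awalk_def cyc_graph_simps)
    have v: "v = (nxt n ^^ length p) u"
      using walk dir cas_all_forward by (auto simp: pre_digraph.awalk_def)
    \<comment> \<open>A path has one more vertex than arcs, and its vertices are distinct.\<close>
    have "length p < n"
    proof -
      have "length (pre_digraph.awalk_verts (cyc_graph n a) u p) = Suc (length p)"
        by (simp add: pre_digraph.awalk_verts_conv)
      moreover have "set (pre_digraph.awalk_verts (cyc_graph n a) u p) \<subseteq> {1..n}"
      proof -
        have "head (cyc_graph n a) f \<in> {1..n}" if "f \<in> set p" for f
        proof -
          have "fst (fst f) \<in> {1..n}"
            using walk that by (auto simp: pre_digraph.awalk_def cyc_graph_simps edges_def)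
          then show ?thesis
            using nxt_in[of n] by (cases f) (simp add: cyc_graph_simps)
        qed
        moreover have "pre_digraph.awalk_verts (cyc_graph n a) u p = u # map (head (cyc_graph n a)) p"
          using walk by (intro awalk_verts_cas[of _ _ _ v]) (simp add: pre_digraph.awalk_def)
        ultimately show ?thesis
          using u by auto
      qed
      ultimately have "Suc (length p) \<le> card {1..n}"
        using path by (metis card_mono distinct_card finite_atLeastAtMost pre_digraph.apath_def)
      then show ?thesis by simp
    qed
    have edge_S: "\<exists>j\<in>{1..a ((nxt n ^^ k) u)}. p ! k = (((nxt n ^^ k) u, j), True) \<and>
      (YR ((nxt n ^^ k) u, j) \<in> S \<or> ZE ((nxt n ^^ k) u, j) \<in> S)" if k: "k < length p" for k
    proof -
      obtain j where j: "p ! k = (((nxt n ^^ k) u, j), True)" "j \<in> {1..a ((nxt n ^^ k) u)}"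
        using forward_walk_nth[OF walk dir k] .
      moreover have "p ! k \<in> P1 \<union> P2"
        using P k by simp
      ultimately show ?thesis
        using S by force
    qed
    have "has_YR a S u"
    proof -
      obtain j where "p ! 0 = ((u, j), True)" "j \<in> {1..a u}"
        using edge_S[of 0] len by (cases p) auto
      moreover have "p ! 0 = hd p"
        using len by (intro hd_conv_nth[symmetric]) auto
      ultimately show ?thesis
        using S P(2) by (force simp: has_YR_def)
    qed
    moreover have "\<not> bare a S ((nxt n ^^ k) u)" if "k < length p" for k
      using edge_S[OF that] by (auto simp: bare_def)
    ultimately show False
      using chain u \<open>length p < n\<close> len S v unfolding chain_free_def
      by (metis atLeastLessThan_iff greaterThanLessThan_iff)
  qed
  show "\<forall>p\<in>zigzag_binomials n a :: 'k mpoly set. avoids S p"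
  proof
    fix b :: "'k mpoly" assume "b \<in> zigzag_binomials n a"
    then obtain u v p P1 P2 where b: "b = X (ZV v) * (\<Prod>f\<in>P1. X (y_var f)) * (\<Prod>f\<in>P2. X (ZE (fst f)))
       - X (ZV u) * (\<Prod>f\<in>P2. X (y_var (opp f))) * (\<Prod>f\<in>P1. X (ZE (fst f)))"
      and path: "pre_digraph.apath (cyc_graph n a) u p v" and len: "length p \<ge> 2"
      and P: "P1 \<union> P2 = set p" "P1 \<inter> P2 = {}" "hd p \<in> P1" "last p \<in> P2"
      unfolding zigzag_binomials_def by blast
    have fin: "finite P1" "finite P2"
      using P(1) by (metis finite_Un finite_set)+
    have dir: "snd f = snd f'" if "f \<in> set p" "f' \<in> set p" for f f'
      using path distinct_walk_direction[OF _ _ _ that]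
      unfolding pre_digraph.apath_def pre_digraph.awalk_def by blast
    have p: "p \<noteq> []" using len by auto
    show "avoids S b"
    proof (cases "snd (hd p)")
      case True
      then have all: "\<forall>f\<in>set p. snd f"
        using dir p by (metis hd_in_set)
      then show ?thesis
        unfolding b using avoids_zigzag_binomial(1)[OF fin, of S v u] P no_chain[OF path all len P(1,3)]
        by auto
    next
      case False
      then have all: "\<forall>f\<in>set p. \<not> snd f"
        using dir p by (metis hd_in_set)
      \<comment> \<open>Reversal exchanges \<open>u\<close> with \<open>v\<close> and
        \<open>P1\<close> with \<open>P2\<close>, matching the change of the leading side for
        backward arcs.\<close>
      define q where "q = rev (map opp p)"
      have "pre_digraph.apath (cyc_graph n a) v q u"
        unfolding q_def by (rule apath_reverse[OF path])
      moreover have "\<forall>f\<in>set q. snd f" "length q \<ge> 2"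
        using all len by (auto simp: q_def opp_def)
      moreover have "opp ` P2 \<union> opp ` P1 = set q"
        by (simp add: q_def P(1)[symmetric] image_Un Un_commute)
      moreover have "hd q \<in> opp ` P2"
        using P(4) p by (simp add: q_def hd_rev last_map)
      ultimately have "\<not> (ZV u \<in> S \<and> (\<forall>f\<in>opp ` P2. YR (fst f) \<in> S) \<and> (\<forall>f\<in>opp ` P1. ZE (fst f) \<in> S))"
        by (rule no_chain)
      then have "\<not> (ZV u \<in> S \<and> (\<forall>f\<in>P2. YR (fst f) \<in> S) \<and> (\<forall>f\<in>P1. ZE (fst f) \<in> S))"
        by (auto simp: opp_def)
      then show ?thesis
        unfolding b using avoids_zigzag_binomial(2)[OF fin, of S v u] P all by auto
    qed
  qed
qed

text \<open>If both arcs lie in one part, a \<open>YR\<close> faces only \<open>ZE\<close>. In the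
  mixed cases both terms contain the same kinds of variables, and the order inside the
  \<open>YR\<close> or \<open>YL\<close> block decides by comparing \<open>j\<close> with
  \<open>k\<close>.\<close>

lemma avoids_parallel:
  fixes C1 C2 :: "arc set"
  assumes "j \<noteq> k" and C: "C1 \<union> C2 = {((i, j), True), ((i, k), False)}" "C1 \<inter> C2 = {}"
  shows "avoids S ((\<Prod>f\<in>C1. X (y_var f)) * (\<Prod>f\<in>C2. X (ZE (fst f)))
       - (\<Prod>f\<in>C2. X (y_var (opp f))) * (\<Prod>f\<in>C1. X (ZE (fst f))) :: 'k::field mpoly) \<longleftrightarrow>
    \<not> (if ((i, j), True) \<in> C1
        then if ((i, k), False) \<in> C1 then {YR (i, j), YL (i, k)}
          else if j < k then {YR (i, j), ZE (i, k)} else {YR (i, k), ZE (i, j)}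
        else if ((i, k), False) \<in> C1
          then if j < k then {YL (i, k), ZE (i, j)} else {YL (i, j), ZE (i, k)}
          else {YR (i, k), YL (i, j)}) \<subseteq> S" (is "avoids S ?b \<longleftrightarrow> _")
proof -
  let ?V = "y_var ` C1 \<union> (\<lambda>f. ZE (fst f)) ` C2"
  let ?W = "(\<lambda>f. y_var (opp f)) ` C2 \<union> (\<lambda>f. ZE (fst f)) ` C1"
  let ?f = "((i, j), True)" and ?g = "((i, k), False)"
  have fin: "finite C1" "finite C2"
    using C(1) by (metis finite_Un finite.emptyI finite_insert)+
  note cyc1 = avoids_cyclic_binomial(1)[OF fin, where S = S]
    and cyc2 = avoids_cyclic_binomial(2)[OF fin, where S = S]
  note [simp] = y_var_def opp_def var_greater_def edge_before_def
  have "C1 \<in> Pow {?f, ?g}" "C2 = {?f, ?g} - C1"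
    using C by blast+
  then consider "C1 = {?f, ?g}" "C2 = {}" | "C1 = {?f}" "C2 = {?g}" | "C1 = {?g}" "C2 = {?f}"
    | "C1 = {}" "C2 = {?f, ?g}"
    by (auto simp: Pow_insert insert_Diff_if)
  then show ?thesis
  proof cases
    case 1
    have "avoids S ?b \<longleftrightarrow> \<not> ?V \<subseteq> S"
      by (rule cyc1[of "YR (i, j)"]) (auto simp: 1)
    then show ?thesis
      by (auto simp: 1)
  next
    case 2
    show ?thesis
    proof (cases "j < k")
      case True
      have "avoids S ?b \<longleftrightarrow> \<not> ?V \<subseteq> S"
        by (rule cyc1[of "YR (i, j)"]) (use True in \<open>auto simp: 2\<close>)
      with True show ?thesis
        by (auto simp: 2)
    next
      case False
      have "avoids S ?b \<longleftrightarrow> \<not> ?W \<subseteq> S"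
        by (rule cyc2[of "YR (i, k)"]) (use False assms(1) in \<open>auto simp: 2\<close>)
      with False show ?thesis
        by (auto simp: 2)
    qed
  next
    case 3
    show ?thesis
    proof (cases "j < k")
      case True
      have "avoids S ?b \<longleftrightarrow> \<not> ?V \<subseteq> S"
        by (rule cyc1[of "YL (i, k)"]) (use True in \<open>auto simp: 3\<close>)
      with True show ?thesis
        by (auto simp: 3)
    next
      case False
      have "avoids S ?b \<longleftrightarrow> \<not> ?W \<subseteq> S"
        by (rule cyc2[of "YL (i, j)"]) (use False assms(1) in \<open>auto simp: 3\<close>)
      with False show ?thesis
        by (auto simp: 3)
    qed
  next
    case 4
    have "avoids S ?b \<longleftrightarrow> \<not> ?W \<subseteq> S"
      by (rule cyc2[of "YR (i, k)"]) (auto simp: 4)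
    then show ?thesis
      by (auto simp: 4)
  qed
qed

text \<open>A \<open>YR\<close> on one side meets only \<open>YL\<close> and \<open>ZE\<close> on
  the other, and without any \<open>YR\<close> the \<open>YL\<close> lead. Reversing the orientation
  exchanges the roles of \<open>C1\<close> and \<open>C2\<close>.\<close>

lemma avoids_full_cycle:
  fixes C1 C2 :: "arc set"
  defines "p \<equiv> (\<Prod>f\<in>C1. X (y_var f)) * (\<Prod>f\<in>C2. X (ZE (fst f)))
       - (\<Prod>f\<in>C2. X (y_var (opp f))) * (\<Prod>f\<in>C1. X (ZE (fst f))) :: 'k::field mpoly"
  assumes fin: "finite C1" "finite C2" and ne: "C1 \<union> C2 \<noteq> {}"
  shows "\<forall>f\<in>C1 \<union> C2. snd f \<Longrightarrow> avoids S p \<longleftrightarrow>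
      \<not> (if C1 = {} then \<forall>f\<in>C2. YL (fst f) \<in> S
         else (\<forall>f\<in>C1. YR (fst f) \<in> S) \<and> (\<forall>f\<in>C2. ZE (fst f) \<in> S))"
    and "\<forall>f\<in>C1 \<union> C2. \<not> snd f \<Longrightarrow> avoids S p \<longleftrightarrow>
      \<not> (if C2 = {} then \<forall>f\<in>C1. YL (fst f) \<in> S
         else (\<forall>f\<in>C2. YR (fst f) \<in> S) \<and> (\<forall>f\<in>C1. ZE (fst f) \<in> S))"
proof -
  let ?V = "y_var ` C1 \<union> (\<lambda>f. ZE (fst f)) ` C2"
  let ?W = "(\<lambda>f. y_var (opp f)) ` C2 \<union> (\<lambda>f. ZE (fst f)) ` C1"
  note cyc1 = avoids_cyclic_binomial(1)[OF fin, where S = S]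
    and cyc2 = avoids_cyclic_binomial(2)[OF fin, where S = S]
  show "avoids S p \<longleftrightarrow> \<not> (if C1 = {} then \<forall>f\<in>C2. YL (fst f) \<in> S
      else (\<forall>f\<in>C1. YR (fst f) \<in> S) \<and> (\<forall>f\<in>C2. ZE (fst f) \<in> S))"
    if dir: "\<forall>f\<in>C1 \<union> C2. snd f"
  proof (cases "C1 = {}")
    case True
    then obtain f where f: "f \<in> C2" "snd f"
      using ne dir by blast
    have "avoids S p \<longleftrightarrow> \<not> ?W \<subseteq> S"
      unfolding p_def using f dir True
      by (intro cyc2[of "y_var (opp f)"]) (auto simp: y_var_def opp_def var_greater_def)
    with True dir show ?thesis by (auto simp: y_var_def opp_def)
  next
    case False
    then obtain f where f: "f \<in> C1" "snd f"
      using dir by blast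
    have "avoids S p \<longleftrightarrow> \<not> ?V \<subseteq> S"
      unfolding p_def using f dir
      by (intro cyc1[of "y_var f"]) (auto simp: y_var_def opp_def var_greater_def)
    with False dir show ?thesis by (auto simp: y_var_def)
  qed
  show "avoids S p \<longleftrightarrow> \<not> (if C2 = {} then \<forall>f\<in>C1. YL (fst f) \<in> S
      else (\<forall>f\<in>C2. YR (fst f) \<in> S) \<and> (\<forall>f\<in>C1. ZE (fst f) \<in> S))"
    if dir: "\<forall>f\<in>C1 \<union> C2. \<not> snd f"
  proof (cases "C2 = {}")
    case True
    then obtain f where f: "f \<in> C1" "\<not> snd f"
      using ne dir by blast
    have "avoids S p \<longleftrightarrow> \<not> ?V \<subseteq> S"
      unfolding p_def using f dir True
      by (intro cyc1[of "y_var f"]) (auto simp: y_var_def opp_def var_greater_def)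
    with True dir show ?thesis by (auto simp: y_var_def)
  next
    case False
    then obtain f where f: "f \<in> C2" "\<not> snd f"
      using dir by blast
    have "avoids S p \<longleftrightarrow> \<not> ?W \<subseteq> S"
      unfolding p_def using f dir
      by (intro cyc2[of "y_var (opp f)"]) (auto simp: y_var_def opp_def var_greater_def)
    with False dir show ?thesis by (auto simp: y_var_def opp_def)
  qed
qed

lemma cycle_parallel:
  assumes "i \<in> {1..n}" "j \<in> {1..a i}" "k \<in> {1..a i}" "n \<ge> 2"
  shows "pre_digraph.cycle (cyc_graph n a) [((i, j), True), ((i, k), False)]"
  unfolding pre_digraph.cycle_def pre_digraph.awalk_def
  using assms nxt_neq[of n i]
  by (intro exI[of _ i])
    (auto simp: pre_digraph.cas.simps pre_digraph.awalk_verts.simps cyc_graph_simps edges_def)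

lemma avoids_cyclic_iff:
  assumes n: "n \<ge> 3" and a: "\<And>i. i \<in> {1..n} \<Longrightarrow> a i \<ge> 1"
  shows "(\<forall>p\<in>cyclic_binomials n a :: 'k::field mpoly set. avoids S p) \<longleftrightarrow>
    parallel_free n a S \<and> cycle_free n a S"
proof
  assume avoid: "\<forall>p\<in>cyclic_binomials n a :: 'k mpoly set. avoids S p"
  have avoid: "avoids S ((\<Prod>f\<in>C1. X (y_var f)) * (\<Prod>f\<in>C2. X (ZE (fst f)))
       - (\<Prod>f\<in>C2. X (y_var (opp f))) * (\<Prod>f\<in>C1. X (ZE (fst f))) :: 'k mpoly)"
    if "pre_digraph.cycle (cyc_graph n a) p" "distinct (map fst p)" "C1 \<union> C2 = set p" "C1 \<inter> C2 = {}"
    for p C1 C2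
  proof -
    have "(\<Prod>f\<in>C1. X (y_var f)) * (\<Prod>f\<in>C2. X (ZE (fst f)))
       - (\<Prod>f\<in>C2. X (y_var (opp f))) * (\<Prod>f\<in>C1. X (ZE (fst f))) \<in> (cyclic_binomials n a :: 'k mpoly set)"
      unfolding cyclic_binomials_def using that by blast
    with avoid show ?thesis by blast
  qed
  have "parallel_free n a S"
    unfolding parallel_free_def
  proof (intro ballI)
    fix i j k assume ijk: "i \<in> {1..n}" "j \<in> {1..a i}" "k \<in> {1..a i}"
    let ?f = "((i, j), True)" and ?g = "((i, k), False)"
    have av: "avoids S ((\<Prod>f\<in>C1. X (y_var f)) * (\<Prod>f\<in>C2. X (ZE (fst f)))
       - (\<Prod>f\<in>C2. X (y_var (opp f))) * (\<Prod>f\<in>C1. X (ZE (fst f))) :: 'k mpoly)"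
      if "j \<noteq> k" "C1 \<union> C2 = {?f, ?g}" "C1 \<inter> C2 = {}" for C1 C2
      using cycle_parallel[of i n j a k] ijk n that by (intro avoid[of "[?f, ?g]"]) auto
    show "(j \<noteq> k \<longrightarrow> \<not> {YR (i, j), YL (i, k)} \<subseteq> S) \<and>
      (j < k \<longrightarrow> \<not> {YR (i, j), ZE (i, k)} \<subseteq> S \<and> \<not> {YL (i, k), ZE (i, j)} \<subseteq> S)"
    proof (cases "j = k")
      case False
      then show ?thesis
        using av[of "{?f, ?g}" "{}"] avoids_parallel[of j k "{?f, ?g}" "{}" i S, where 'k = 'k]
          av[of "{?f}" "{?g}"] avoids_parallel[of j k "{?f}" "{?g}" i S, where 'k = 'k]
          av[of "{?g}" "{?f}"] avoids_parallel[of j k "{?g}" "{?f}" i S, where 'k = 'k]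
        by (auto split: if_splits)
    qed auto
  qed
  moreover have "cycle_free n a S"
    unfolding cycle_free_def
  proof (intro conjI impI)
    have cyc: "pre_digraph.cycle (cyc_graph n a) (forward n g 1 n)" "distinct (map fst (forward n g 1 n))"
      "forward n g 1 n \<noteq> []" "set (forward n g 1 n) = {((i, g i), True) | i. i \<in> {1..n}}"
      if "\<And>i. i \<in> {1..n} \<Longrightarrow> g i \<in> {1..a i}" for g
    proof -
      have one: "1 \<in> {1..n}" using n by simp
      show "pre_digraph.cycle (cyc_graph n a) (forward n g 1 n)"
        using cycle_forward[of 1 n g a] one that by blast
      show "distinct (map fst (forward n g 1 n))"
        using funpow_nxt_eq_iff[OF one] by (auto simp: forward_def distinct_map inj_on_def)
      show "forward n g 1 n \<noteq> []"
        using n by (simp add: forward_def)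
      show "set (forward n g 1 n) = {((i, g i), True) | i. i \<in> {1..n}}"
        using funpow_nxt_in[OF one] funpow_nxt_surj[OF one] by (fastforce simp: forward_def)
    qed
    show "\<exists>i\<in>{1..n}. bare a S i" if YR: "\<exists>i\<in>{1..n}. has_YR a S i"
    proof (rule ccontr)
      assume not_bare: "\<not> (\<exists>i\<in>{1..n}. bare a S i)"
      obtain g where g: "\<And>i. i \<in> {1..n} \<Longrightarrow> g i \<in> {1..a i}"
        "\<And>i. i \<in> {1..n} \<Longrightarrow> has_YR a S i \<Longrightarrow> YR (i, g i) \<in> S"
        "\<And>i. i \<in> {1..n} \<Longrightarrow> \<not> bare a S i \<Longrightarrow> YR (i, g i) \<in> S \<or> ZE (i, g i) \<in> S"
        using choose_edges[of n a S] a by metis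
      define p where "p = forward n g 1 n"
      have c: "pre_digraph.cycle (cyc_graph n a) p" "distinct (map fst p)" "p \<noteq> []"
        "set p = {((i, g i), True) | i. i \<in> {1..n}}"
        unfolding p_def by (rule cyc, rule g(1), assumption)+
      \<comment> \<open>As for zigzags, \<open>S\<close> chooses the partition. The given
        \<open>YR\<close> makes \<open>C1\<close> non-empty, so the side with \<open>YR\<close>
        leads.\<close>
      define C1 where "C1 = {f \<in> set p. YR (fst f) \<in> S}"
      define C2 where "C2 = set p - C1"
      have "avoids S ((\<Prod>f\<in>C1. X (y_var f)) * (\<Prod>f\<in>C2. X (ZE (fst f)))
         - (\<Prod>f\<in>C2. X (y_var (opp f))) * (\<Prod>f\<in>C1. X (ZE (fst f))) :: 'k mpoly)"
        using c(1,2) by (intro avoid[of p]) (auto simp: C1_def C2_def)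
      moreover have "finite C1" "finite C2" "\<forall>f\<in>C1 \<union> C2. snd f"
        using c(4) by (auto simp: C1_def C2_def)
      moreover have "C1 \<noteq> {}"
      proof -
        obtain i where "i \<in> {1..n}" "has_YR a S i"
          using YR by blast
        then have "((i, g i), True) \<in> C1"
          using g(2) by (auto simp: C1_def c(4))
        then show ?thesis by blast
      qed
      ultimately have "\<not> ((\<forall>f\<in>C1. YR (fst f) \<in> S) \<and> (\<forall>f\<in>C2. ZE (fst f) \<in> S))"
        using avoids_full_cycle(1)[where ?C1.0 = C1 and ?C2.0 = C2 and S = S and 'k = 'k] by auto
      moreover have "\<forall>f\<in>C1. YR (fst f) \<in> S"
        by (simp add: C1_def)
      moreover have "\<forall>f\<in>C2. ZE (fst f) \<in> S"
      proof
        fix f assume f: "f \<in> C2"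
        then obtain i where "i \<in> {1..n}" "f = ((i, g i), True)"
          by (auto simp: C2_def c(4))
        with f show "ZE (fst f) \<in> S"
          using g(3) not_bare by (force simp: C1_def C2_def)
      qed
      ultimately show False
        by blast
    qed
    show "\<exists>i\<in>{1..n}. \<not> has_YL a S i"
    proof (rule ccontr)
      assume "\<not> (\<exists>i\<in>{1..n}. \<not> has_YL a S i)"
      then have "\<forall>i\<in>{1..n}. \<exists>j. j \<in> {1..a i} \<and> YL (i, j) \<in> S"
        unfolding has_YL_def by blast
      then obtain g where g: "\<And>i. i \<in> {1..n} \<Longrightarrow> g i \<in> {1..a i}"
        "\<And>i. i \<in> {1..n} \<Longrightarrow> YL (i, g i) \<in> S"
        unfolding bchoice_iff by blast
      define p where "p = forward n g 1 n"
      have c: "pre_digraph.cycle (cyc_graph n a) p" "distinct (map fst p)" "p \<noteq> []"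
        "set p = {((i, g i), True) | i. i \<in> {1..n}}"
        unfolding p_def by (rule cyc, rule g(1), assumption)+
      \<comment> \<open>The opposite extreme: with the first part empty, the binomial compares a
        product of \<open>ZE\<close> with a product of \<open>YL\<close>.\<close>
      have "avoids S ((\<Prod>f\<in>{}. X (y_var f)) * (\<Prod>f\<in>set p. X (ZE (fst f)))
         - (\<Prod>f\<in>set p. X (y_var (opp f))) * (\<Prod>f\<in>({} :: arc set). X (ZE (fst f))) :: 'k mpoly)"
        using c(1,2) by (intro avoid[of p]) (auto simp: p_def)
      moreover have "{} \<union> set p \<noteq> {}"
        using c(3) by simp
      moreover have "\<forall>f\<in>{} \<union> set p. snd f"
        by (auto simp: c(4))
      ultimately have "\<not> (\<forall>f\<in>set p. YL (fst f) \<in> S)"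
        using avoids_full_cycle(1)[OF finite.emptyI finite_set, of p S, where 'k = 'k] by simp
      with g(2) c(4) show False
        by auto
    qed
  qed
  ultimately show "parallel_free n a S \<and> cycle_free n a S" ..
next
  assume free: "parallel_free n a S \<and> cycle_free n a S"
  show "\<forall>p\<in>cyclic_binomials n a :: 'k mpoly set. avoids S p"
  proof
    fix b :: "'k mpoly" assume "b \<in> cyclic_binomials n a"
    then obtain p C1 C2 where b: "b = (\<Prod>f\<in>C1. X (y_var f)) * (\<Prod>f\<in>C2. X (ZE (fst f)))
       - (\<Prod>f\<in>C2. X (y_var (opp f))) * (\<Prod>f\<in>C1. X (ZE (fst f)))"
      and cyc: "pre_digraph.cycle (cyc_graph n a) p" "distinct (map fst p)"
      and C: "C1 \<union> C2 = set p" "C1 \<inter> C2 = {}"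
      unfolding cyclic_binomials_def by blast
    have fin: "finite C1" "finite C2"
      using C(1) by (metis finite_Un finite_set)+
    from n cyc show "avoids S b"
    proof (cases rule: cycle_cases)
      case (parallel i j k d)
      \<comment> \<open>\<open>j'\<close> is the edge traversed forward, whichever arc comes first
        in \<open>p\<close>.\<close>
      obtain j' k' where jk: "j' \<in> {1..a i}" "k' \<in> {1..a i}" "j' \<noteq> k'"
        "C1 \<union> C2 = {((i, j'), True), ((i, k'), False)}"
        using parallel C(1) by (cases d) auto
      have "\<not> {YR (i, j), YL (i, k)} \<subseteq> S" "j < k \<Longrightarrow> \<not> {YR (i, j), ZE (i, k)} \<subseteq> S"
        "j < k \<Longrightarrow> \<not> {YL (i, k), ZE (i, j)} \<subseteq> S"
        if "j \<in> {1..a i}" "k \<in> {1..a i}" "j \<noteq> k" for j k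
        using free parallel(1) that unfolding parallel_free_def by blast+
      from this[OF jk(1-3)] this[OF jk(2,1) jk(3)[symmetric]] show ?thesis
        unfolding b avoids_parallel[OF jk(3,4) C(2)] using jk(3) by (auto simp: nat_neq_iff)
    next
      case (full d)
      have ne: "C1 \<union> C2 \<noteq> {}"
        using full(3) n C(1) by fastforce
      \<comment> \<open>\<open>E1\<close> collects the arcs that enter a monomial through
        \<open>YR\<close>, for either orientation of the cycle.\<close>
      define E1 where "E1 = (if d then C1 else C2)"
      define E2 where "E2 = (if d then C2 else C1)"
      have E: "E1 \<union> E2 = set p"
        using C by (auto simp: E1_def E2_def)
      have mem: "\<exists>f\<in>set p. fst f \<in> {i} \<times> {1..a i}" if i: "i \<in> {1..n}" for i
      proof -
        obtain j where "j \<in> {1..a i}" "((i, j), d) \<in> set p"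
          using full(3) i by blast
        then show ?thesis
          by (intro bexI[of _ "((i, j), d)"]) auto
      qed
      have edges: "fst f \<in> edges n a" if "f \<in> set p" for f
        using full(2) that by (auto simp: cyc_graph_simps)
      have "\<not> (if E1 = {} then \<forall>f\<in>E2. YL (fst f) \<in> S
         else (\<forall>f\<in>E1. YR (fst f) \<in> S) \<and> (\<forall>f\<in>E2. ZE (fst f) \<in> S))"
      proof (cases "E1 = {}")
        case True
        obtain i where i: "i \<in> {1..n}" "\<not> has_YL a S i"
          using free by (auto simp: cycle_free_def)
        then show ?thesis
          using mem[OF i(1)] True E by (force simp: has_YL_def)
      next
        case False
        show ?thesis
        proof
          assume "if E1 = {} then \<forall>f\<in>E2. YL (fst f) \<in> S
            else (\<forall>f\<in>E1. YR (fst f) \<in> S) \<and> (\<forall>f\<in>E2. ZE (fst f) \<in> S)"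
          with False have S: "\<forall>f\<in>E1. YR (fst f) \<in> S" "\<forall>f\<in>E2. ZE (fst f) \<in> S"
            by auto
          obtain f where "f \<in> E1" using False by blast
          obtain i j where ij: "fst f = (i, j)"
            by (cases "fst f")
          have "(i, j) \<in> edges n a" "YR (i, j) \<in> S"
            using S(1) edges[of f] E \<open>f \<in> E1\<close> by (auto simp flip: ij)
          then have "has_YR a S i" "i \<in> {1..n}"
            by (auto simp: has_YR_def edges_def)
          then obtain i where i: "i \<in> {1..n}" "bare a S i"
            using free by (auto simp: cycle_free_def)
          then show False
            using mem[OF i(1)] S E by (force simp: bare_def)
        qed
      qed
      note not_all = this
      show ?thesis
      proof (cases d)
        case True
        then have E: "E1 = C1" "E2 = C2"
          by (simp_all add: E1_def E2_def)
        have "\<forall>f\<in>C1 \<union> C2. snd f"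
          using full(1) C(1) True by simp
        from avoids_full_cycle(1)[OF fin ne this, of S, where 'k = 'k] show ?thesis
          using not_all unfolding b E by (simp only: not_False_eq_True)
      next
        case False
        then have E: "E1 = C2" "E2 = C1"
          by (simp_all add: E1_def E2_def)
        have "\<forall>f\<in>C1 \<union> C2. \<not> snd f"
          using full(1) C(1) False by simp
        from avoids_full_cycle(2)[OF fin ne this, of S, where 'k = 'k] show ?thesis
          using not_all unfolding b E by (simp only: not_False_eq_True)
      qed
    qed
  qed
qed

lemma facet_iff:
  assumes "n \<ge> 3" "\<And>i. i \<in> {1..n} \<Longrightarrow> a i \<ge> 1"
  shows "facet (binomials n a :: 'k::field mpoly set) n a S \<longleftrightarrow>
    S \<subseteq> vars n a \<and> card S = n + (\<Sum>i=1..n. a i) \<and>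
    edge_free n a S \<and> parallel_free n a S \<and> chain_free n a S \<and> cycle_free n a S"
proof -
  have "(\<forall>p\<in>binomials n a :: 'k mpoly set. avoids S p) \<longleftrightarrow>
      edge_free n a S \<and> parallel_free n a S \<and> chain_free n a S \<and> cycle_free n a S"
    using avoids_fundamental_iff[of n a S, where 'k = 'k] avoids_zigzag_iff[of n a S, where 'k = 'k]
      avoids_cyclic_iff[of n a S, where 'k = 'k] assms
    unfolding binomials_def ball_Un by blast
  then show ?thesis
    by (simp add: facet_def avoids_def)
qed

subsection \<open>Contributions of a multi-edge\<close>

definition contribution :: "(nat \<Rightarrow> nat) \<Rightarrow> var set \<Rightarrow> nat \<Rightarrow> nat" where
  "contribution a S i = (\<Sum>j=1..a i. card (S \<inter> edge_vars (i, j)))"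

text \<open>Under \<open>edge_free\<close> these are the only ways in which one edge can contribute
  two variables; three always include a forbidden pair.\<close>

definition doubled :: "var set \<Rightarrow> edge \<Rightarrow> bool" where
  "doubled S e \<longleftrightarrow> ZE e \<in> S \<and> (YR e \<in> S \<or> YL e \<in> S)"

definition paired :: "(nat \<Rightarrow> nat) \<Rightarrow> var set \<Rightarrow> nat \<Rightarrow> bool" where
  "paired a S i \<longleftrightarrow> (\<exists>j\<in>{1..a i}. doubled S (i, j))"

lemma inter_edge_vars:
  "S \<inter> edge_vars e = (if YR e \<in> S then {YR e} else {}) \<union> (if YL e \<in> S then {YL e} else {}) \<union>
    (if T e \<in> S then {T e} else {}) \<union> (if ZE e \<in> S then {ZE e} else {})"
  by (auto simp: edge_vars_def)

lemma card_inter_edge_vars: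
  "card (S \<inter> edge_vars e) = of_bool (YR e \<in> S) + of_bool (YL e \<in> S) + of_bool (T e \<in> S) + of_bool (ZE e \<in> S)"
  unfolding inter_edge_vars by auto

lemma contributes_one_of_edge_vars: "contributes_one_of S e (edge_vars e) \<longleftrightarrow> card (S \<inter> edge_vars e) = 1"
  by (auto simp: contributes_one_of_def card_1_singleton_iff)

lemma contributes_one_of_simps:
  "contributes_one_of S e {T e, ZE e} \<longleftrightarrow> YR e \<notin> S \<and> YL e \<notin> S \<and> (T e \<in> S \<longleftrightarrow> ZE e \<notin> S)"
  "contributes_one_of S e {ZE e, T e} \<longleftrightarrow> YR e \<notin> S \<and> YL e \<notin> S \<and> (T e \<in> S \<longleftrightarrow> ZE e \<notin> S)"
  "contributes_one_of S e {T e, YR e} \<longleftrightarrow> ZE e \<notin> S \<and> YL e \<notin> S \<and> (T e \<in> S \<longleftrightarrow> YR e \<notin> S)"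
  "contributes_one_of S e {T e, YL e} \<longleftrightarrow> YR e \<notin> S \<and> ZE e \<notin> S \<and> (T e \<in> S \<longleftrightarrow> YL e \<notin> S)"
  "contributes_one_of S e {YL e, T e} \<longleftrightarrow> YR e \<notin> S \<and> ZE e \<notin> S \<and> (T e \<in> S \<longleftrightarrow> YL e \<notin> S)"
  unfolding contributes_one_of_def edge_vars_def by (auto simp: set_eq_iff)

lemma contributes_one_of_if_card:
  assumes "card (S \<inter> edge_vars e) = 1"
  shows "YR e \<notin> S \<Longrightarrow> YL e \<notin> S \<Longrightarrow> contributes_one_of S e {ZE e, T e}"
    and "YR e \<notin> S \<Longrightarrow> ZE e \<notin> S \<Longrightarrow> contributes_one_of S e {YL e, T e}"
  using assms unfolding card_inter_edge_vars contributes_one_of_simps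
  by (simp_all add: of_bool_def split: if_splits)

lemma inter_edge_vars_pair:
  "S \<inter> edge_vars e = {YR e, ZE e} \<longleftrightarrow> YR e \<in> S \<and> ZE e \<in> S \<and> YL e \<notin> S \<and> T e \<notin> S"
  "S \<inter> edge_vars e = {YL e, ZE e} \<longleftrightarrow> YL e \<in> S \<and> ZE e \<in> S \<and> YR e \<notin> S \<and> T e \<notin> S"
  unfolding edge_vars_def by (auto simp: set_eq_iff)

lemma type_A_iff:
  "type_A a S i \<longleftrightarrow> (\<exists>j\<in>{1..a i}.
    YR (i, j) \<in> S \<and> ZE (i, j) \<in> S \<and> YL (i, j) \<notin> S \<and> T (i, j) \<notin> S \<and>
    (\<forall>k\<in>{1..a i}.
      (k < j \<longrightarrow> YR (i, k) \<notin> S \<and> YL (i, k) \<notin> S \<and> (T (i, k) \<in> S \<longleftrightarrow> ZE (i, k) \<notin> S)) \<and>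
      (k > j \<longrightarrow> ZE (i, k) \<notin> S \<and> YL (i, k) \<notin> S \<and> (T (i, k) \<in> S \<longleftrightarrow> YR (i, k) \<notin> S))))"
  unfolding type_A_def contributes_one_of_simps inter_edge_vars_pair by simp

lemma type_B_iff:
  "type_B a S i \<longleftrightarrow> (\<exists>j\<in>{1..a i}.
    YL (i, j) \<in> S \<and> ZE (i, j) \<in> S \<and> YR (i, j) \<notin> S \<and> T (i, j) \<notin> S \<and>
    (\<forall>k\<in>{1..a i}.
      (k < j \<longrightarrow> YR (i, k) \<notin> S \<and> ZE (i, k) \<notin> S \<and> (T (i, k) \<in> S \<longleftrightarrow> YL (i, k) \<notin> S)) \<and>
      (k > j \<longrightarrow> YR (i, k) \<notin> S \<and> YL (i, k) \<notin> S \<and> (T (i, k) \<in> S \<longleftrightarrow> ZE (i, k) \<notin> S))))"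
  unfolding type_B_def contributes_one_of_simps inter_edge_vars_pair by simp

lemma type_A_properties:
  assumes "type_A a S i"
  shows "has_YR a S i" "\<not> has_YL a S i" "\<not> bare a S i"
  using assms unfolding type_A_iff has_YR_def has_YL_def bare_def by (metis linorder_neqE_nat)+

lemma type_B_properties:
  assumes "type_B a S i"
  shows "has_YL a S i" "\<not> has_YR a S i" "\<not> bare a S i"
  using assms unfolding type_B_iff has_YR_def has_YL_def bare_def by (metis linorder_neqE_nat)+

lemma sum_except_one:
  fixes f :: "nat \<Rightarrow> nat"
  assumes "j \<in> {1..m}" "f j = 2" "\<And>k. k \<in> {1..m} \<Longrightarrow> k \<noteq> j \<Longrightarrow> f k = 1"
  shows "(\<Sum>k=1..m. f k) = m + 1"
proof -
  have "(\<Sum>k=1..m. f k) = (\<Sum>k=1..m. 1 + of_bool (k = j))"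
    using assms by (intro sum.cong) auto
  also have "\<dots> = m + 1"
    using assms(1) by (simp add: sum_Suc of_bool_def)
  finally show ?thesis .
qed

lemma contribution_type_A:
  assumes "type_A a S i"
  shows "contribution a S i = a i + 1"
proof -
  obtain j where j: "j \<in> {1..a i}"
    "YR (i, j) \<in> S \<and> ZE (i, j) \<in> S \<and> YL (i, j) \<notin> S \<and> T (i, j) \<notin> S"
    "\<And>k. k \<in> {1..a i} \<Longrightarrow>
      (k < j \<longrightarrow> YR (i, k) \<notin> S \<and> YL (i, k) \<notin> S \<and> (T (i, k) \<in> S \<longleftrightarrow> ZE (i, k) \<notin> S)) \<and>
      (k > j \<longrightarrow> ZE (i, k) \<notin> S \<and> YL (i, k) \<notin> S \<and> (T (i, k) \<in> S \<longleftrightarrow> YR (i, k) \<notin> S))"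
    using assms unfolding type_A_iff by blast
  show ?thesis
    unfolding contribution_def
  proof (rule sum_except_one[OF j(1)])
    show "card (S \<inter> edge_vars (i, j)) = 2"
      using j(2) by (simp add: card_inter_edge_vars)
    show "card (S \<inter> edge_vars (i, k)) = 1" if "k \<in> {1..a i}" "k \<noteq> j" for k
      using j(3)[OF that(1)] that(2) by (cases "k < j") (auto simp: card_inter_edge_vars)
  qed
qed

lemma contribution_type_B:
  assumes "type_B a S i"
  shows "contribution a S i = a i + 1"
proof -
  obtain j where j: "j \<in> {1..a i}"
    "YL (i, j) \<in> S \<and> ZE (i, j) \<in> S \<and> YR (i, j) \<notin> S \<and> T (i, j) \<notin> S"
    "\<And>k. k \<in> {1..a i} \<Longrightarrow>
      (k < j \<longrightarrow> YR (i, k) \<notin> S \<and> ZE (i, k) \<notin> S \<and> (T (i, k) \<in> S \<longleftrightarrow> YL (i, k) \<notin> S)) \<and>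
      (k > j \<longrightarrow> YR (i, k) \<notin> S \<and> YL (i, k) \<notin> S \<and> (T (i, k) \<in> S \<longleftrightarrow> ZE (i, k) \<notin> S))"
    using assms unfolding type_B_iff by blast
  show ?thesis
    unfolding contribution_def
  proof (rule sum_except_one[OF j(1)])
    show "card (S \<inter> edge_vars (i, j)) = 2"
      using j(2) by (simp add: card_inter_edge_vars)
    show "card (S \<inter> edge_vars (i, k)) = 1" if "k \<in> {1..a i}" "k \<noteq> j" for k
      using j(3)[OF that(1)] that(2) by (cases "k < j") (auto simp: card_inter_edge_vars)
  qed
qed

lemma contribution_type_C: "type_C a S i \<Longrightarrow> contribution a S i = a i"
  by (simp add: contribution_def type_C_def contributes_one_of_edge_vars)

lemma card_eq_contributions:
  assumes "S \<subseteq> vars n a"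
  shows "card S = card (S \<inter> ZV ` {1..n}) + (\<Sum>i=1..n. contribution a S i)"
proof -
  have fin: "finite (edges n a)" "finite (edge_vars e)" for e
    by (auto simp: edges_def edge_vars_def)
  have "S = (S \<inter> ZV ` {1..n}) \<union> (\<Union>e\<in>edges n a. S \<inter> edge_vars e)"
    using assms by (auto simp: vars_def)
  moreover have "card ((S \<inter> ZV ` {1..n}) \<union> (\<Union>e\<in>edges n a. S \<inter> edge_vars e)) =
      card (S \<inter> ZV ` {1..n}) + card (\<Union>e\<in>edges n a. S \<inter> edge_vars e)"
    by (rule card_Un_disjoint) (use fin in \<open>auto simp: edge_vars_def\<close>)
  moreover have "card (\<Union>e\<in>edges n a. S \<inter> edge_vars e) = (\<Sum>e\<in>edges n a. card (S \<inter> edge_vars e))"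
    by (rule card_UN_disjoint) (use fin in \<open>auto simp: edge_vars_def\<close>)
  moreover have "\<dots> = (\<Sum>i=1..n. contribution a S i)"
    unfolding edges_def contribution_def by (subst sum.Sigma) (auto simp: split_def)
  ultimately show ?thesis
    by metis
qed

context
  fixes n :: nat and a :: "nat \<Rightarrow> nat" and S :: "var set" and i :: nat
  assumes edge: "edge_free n a S" and parallel: "parallel_free n a S" and i: "i \<in> {1..n}"
begin

lemma edge_freeD:
  assumes "j \<in> {1..a i}"
  shows "YR (i, j) \<in> S \<Longrightarrow> YL (i, j) \<notin> S \<and> T (i, j) \<notin> S" "YL (i, j) \<in> S \<Longrightarrow> T (i, j) \<notin> S"
    "ZE (i, j) \<in> S \<Longrightarrow> T (i, j) \<notin> S"
  using edge i assms unfolding edge_free_def edges_def by auto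

lemma parallel_freeD:
  assumes "j \<in> {1..a i}" "k \<in> {1..a i}"
  shows "YR (i, j) \<in> S \<Longrightarrow> YL (i, k) \<notin> S"
    "j < k \<Longrightarrow> YR (i, j) \<in> S \<Longrightarrow> ZE (i, k) \<notin> S" "j < k \<Longrightarrow> YL (i, k) \<in> S \<Longrightarrow> ZE (i, j) \<notin> S"
  using parallel[unfolded parallel_free_def, rule_format, OF i assms] edge_freeD(1)[OF assms(1)]
  by (cases "j = k"; auto)+

lemma card_not_doubled:
  assumes "j \<in> {1..a i}" "\<not> doubled S (i, j)"
  shows "card (S \<inter> edge_vars (i, j)) \<le> 1"
  using assms(2) edge_freeD[OF assms(1)] by (auto simp: card_inter_edge_vars doubled_def of_bool_def)

lemma card_doubled:
  assumes "j \<in> {1..a i}" "doubled S (i, j)"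
  shows "card (S \<inter> edge_vars (i, j)) = 2"
  using assms(2) edge_freeD[OF assms(1)] by (auto simp: card_inter_edge_vars doubled_def of_bool_def)

text \<open>Let j < k. \<open>ZE (i, k)\<close> excludes \<open>YR (i, j)\<close>, so edge j has its
  \<open>YL\<close>; \<open>ZE (i, j)\<close> excludes \<open>YL (i, k)\<close>, so edge k has its
  \<open>YR\<close>. But \<open>YR\<close> and \<open>YL\<close> of different parallel edges exclude
  each other.\<close>

lemma doubled_unique:
  assumes "j \<in> {1..a i}" "k \<in> {1..a i}" "doubled S (i, j)" "doubled S (i, k)"
  shows "j = k"
  using assms(3,4) parallel_freeD[OF assms(1,2)] parallel_freeD[OF assms(2,1)] linorder_neqE_nat
  unfolding doubled_def by metis

lemma contribution_le: "contribution a S i \<le> a i + of_bool (paired a S i)"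
proof -
  have "contribution a S i \<le> (\<Sum>j=1..a i. 1 + of_bool (doubled S (i, j)))"
    unfolding contribution_def
    by (intro sum_mono) (metis card_doubled card_not_doubled add.right_neutral of_bool_eq(1,2)
        one_add_one order_refl)
  also have "\<dots> = a i + card ({1..a i} \<inter> {j. doubled S (i, j)})"
    by (simp add: sum_Suc)
  also have "card ({1..a i} \<inter> {j. doubled S (i, j)}) \<le> of_bool (paired a S i)"
  proof (cases "paired a S i")
    case True
    then show ?thesis
      using doubled_unique by (intro order_trans[OF card_le_Suc0_iff_eq[THEN iffD2]]) auto
  next
    case False
    then have "{1..a i} \<inter> {j. doubled S (i, j)} = {}"
      by (auto simp: paired_def)
    then show ?thesis by simp
  qed
  finally show ?thesis by simp
qed

lemma type_C_if_tight:
  assumes "\<not> paired a S i" "contribution a S i = a i"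
  shows "type_C a S i"
proof -
  have "card (S \<inter> edge_vars (i, j)) = 1" if "j \<in> {1..a i}" for j
  proof (rule sum_mono_inv[where I = "{1..a i}" and f = "\<lambda>j. card (S \<inter> edge_vars (i, j))" and g = "\<lambda>_. 1"])
    show "card (S \<inter> edge_vars (i, j)) \<le> 1" if "j \<in> {1..a i}" for j
      using assms(1) that by (intro card_not_doubled) (auto simp: paired_def)
  qed (use assms(2) that in \<open>simp_all add: contribution_def\<close>)
  then show ?thesis
    by (simp add: type_C_def contributes_one_of_edge_vars)
qed

text \<open>Equality in the bound means equality for every edge. The \<open>y\<close>-variable of
  the doubled edge \<open>j\<close> then determines which variables survive on each side of
  \<open>j\<close>, since the constraints on parallel edges depend on the order of indices.\<close>

lemma type_A_or_B_if_tight: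
  assumes "paired a S i" "contribution a S i = a i + 1"
  shows "type_A a S i \<or> type_B a S i"
proof -
  obtain j where j: "j \<in> {1..a i}" "doubled S (i, j)"
    using assms(1) by (auto simp: paired_def)
  have "card (S \<inter> edge_vars (i, k)) = 1 + of_bool (k = j)" if "k \<in> {1..a i}" for k
  proof (rule sum_mono_inv[where I = "{1..a i}" and f = "\<lambda>k. card (S \<inter> edge_vars (i, k))"
        and g = "\<lambda>k. 1 + of_bool (k = j)"])
    show "(\<Sum>k=1..a i. card (S \<inter> edge_vars (i, k))) = (\<Sum>k=1..a i. 1 + of_bool (k = j))"
      using assms(2) j(1) by (simp add: contribution_def sum_Suc of_bool_def)
    show "card (S \<inter> edge_vars (i, k)) \<le> 1 + of_bool (k = j)" if "k \<in> {1..a i}" for k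
    proof (cases "k = j")
      case True
      then show ?thesis using card_doubled[OF j] by simp
    next
      case False
      then have "\<not> doubled S (i, k)"
        using doubled_unique[OF that j(1) _ j(2)] by blast
      then show ?thesis using card_not_doubled[OF that] False by simp
    qed
  qed (use that in simp_all)
  then have one: "card (S \<inter> edge_vars (i, k)) = 1" if "k \<in> {1..a i}" "k \<noteq> j" for k
    using that by simp
  show ?thesis
  proof (cases "YR (i, j) \<in> S")
    case True
    have "(k < j \<longrightarrow> YR (i, k) \<notin> S \<and> YL (i, k) \<notin> S \<and> (T (i, k) \<in> S \<longleftrightarrow> ZE (i, k) \<notin> S)) \<and>
      (k > j \<longrightarrow> ZE (i, k) \<notin> S \<and> YL (i, k) \<notin> S \<and> (T (i, k) \<in> S \<longleftrightarrow> YR (i, k) \<notin> S))"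
      if k: "k \<in> {1..a i}" for k
      using one[OF k] parallel_freeD[OF k j(1)] parallel_freeD[OF j(1) k] True j(2)
      by (auto simp: card_inter_edge_vars doubled_def of_bool_def split: if_splits)
    then have "type_A a S i"
      unfolding type_A_iff using True j edge_freeD[OF j(1)] by (intro bexI[of _ j]) (auto simp: doubled_def)
    then show ?thesis ..
  next
    case False
    then have YL: "YL (i, j) \<in> S"
      using j(2) by (simp add: doubled_def)
    have "(k < j \<longrightarrow> YR (i, k) \<notin> S \<and> ZE (i, k) \<notin> S \<and> (T (i, k) \<in> S \<longleftrightarrow> YL (i, k) \<notin> S)) \<and>
      (k > j \<longrightarrow> YR (i, k) \<notin> S \<and> YL (i, k) \<notin> S \<and> (T (i, k) \<in> S \<longleftrightarrow> ZE (i, k) \<notin> S))"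
      if k: "k \<in> {1..a i}" for k
      using one[OF k] parallel_freeD[OF k j(1)] parallel_freeD[OF j(1) k] YL j(2)
      by (auto simp: card_inter_edge_vars doubled_def of_bool_def split: if_splits)
    then have "type_B a S i"
      unfolding type_B_iff using False YL j edge_freeD[OF j(1)] by (intro bexI[of _ j]) (auto simp: doubled_def)
    then show ?thesis ..
  qed
qed

end

subsection \<open>Segments between consecutive vertex variables\<close>

text \<open>The two forms at once: \<open>q\<close> is the position of the unique multi-edge of type C, and form (2) is
  the case \<open>q = 0\<close>.\<close>

definition segment_form :: "(nat \<Rightarrow> nat) \<Rightarrow> var set \<Rightarrow> (nat \<Rightarrow> nat) \<Rightarrow> nat \<Rightarrow> nat \<Rightarrow> bool" where
  "segment_form a S h m q \<longleftrightarrow> q < m \<and> type_C a S (h q) \<and> (\<forall>r. q < r \<and> r < m \<longrightarrow> type_B a S (h r)) \<and>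
    (if q = 0 then \<forall>j\<in>{1..a (h 0)}. contributes_one_of S (h 0, j) {ZE (h 0, j), T (h 0, j)}
     else type_A a S (h 0) \<and> (\<forall>r. 0 < r \<and> r < q \<longrightarrow> type_A a S (h r) \<or> type_B a S (h r)) \<and>
       (\<forall>j\<in>{1..a (h q)}. contributes_one_of S (h q, j) {YL (h q, j), T (h q, j)}))"

text \<open>The position \<open>q\<close> of \<open>c\<close> replaces the decomposition; it is one
  more than the length of \<open>As\<close> because the head precedes \<open>As\<close>.\<close>

lemma list_split_iff:
  "(\<exists>i As c Bs. L = i # As @ c # Bs \<and> P i \<and> (\<forall>x\<in>set As. Q x) \<and> R c \<and> (\<forall>x\<in>set Bs. U x)) \<longleftrightarrow>
    (\<exists>q. 0 < q \<and> q < length L \<and> P (L ! 0) \<and> (\<forall>r. 0 < r \<and> r < q \<longrightarrow> Q (L ! r)) \<and> R (L ! q) \<and>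
      (\<forall>r. q < r \<and> r < length L \<longrightarrow> U (L ! r)))" (is "?lhs \<longleftrightarrow> ?rhs")
proof
  assume ?lhs
  then obtain i As c Bs where L: "L = i # As @ c # Bs" and PQRU: "P i" "\<forall>x\<in>set As. Q x" "R c" "\<forall>x\<in>set Bs. U x"
    by blast
  show ?rhs
  proof (intro exI[of _ "Suc (length As)"] conjI allI impI)
    show "Q (L ! r)" if "0 < r \<and> r < Suc (length As)" for r
      using that PQRU(2) by (cases r) (auto simp: L nth_append)
    show "U (L ! r)" if "Suc (length As) < r \<and> r < length L" for r
    proof -
      have "L ! r = Bs ! (r - Suc (Suc (length As)))" "r - Suc (Suc (length As)) < length Bs"
        using that by (auto simp: L nth_Cons' nth_append)
      then show ?thesis
        using PQRU(4) by simp
    qed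
  qed (use PQRU in \<open>simp_all add: L\<close>)
next
  assume ?rhs
  then obtain q where q: "0 < q" "q < length L" "P (L ! 0)" "\<forall>r. 0 < r \<and> r < q \<longrightarrow> Q (L ! r)" "R (L ! q)"
    "\<forall>r. q < r \<and> r < length L \<longrightarrow> U (L ! r)"
    by blast
  have "L = L ! 0 # tl (take q L) @ L ! q # drop (Suc q) L"
  proof -
    have "take q L \<noteq> []" "hd (take q L) = L ! 0"
      using q(1,2) by (cases L; cases q; simp)+
    then have "take q L = L ! 0 # tl (take q L)"
      by (metis list.collapse)
    with id_take_nth_drop[OF q(2)] show ?thesis
      by (metis append_Cons)
  qed
  moreover have "\<forall>x\<in>set (tl (take q L)). Q x"
    using q(2,4) by (auto simp: in_set_conv_nth nth_tl)
  moreover have "\<forall>x\<in>set (drop (Suc q) L). U x"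
    using q(6) by (auto simp: in_set_conv_nth)
  ultimately show ?lhs
    using q(3,5) by blast
qed

lemma form1_map_iff:
  "form1 a S (map h [0..<m]) \<longleftrightarrow> (\<exists>q>0. segment_form a S h m q)"
proof -
  have "form1 a S (map h [0..<m]) \<longleftrightarrow>
    (\<exists>i As c Bs. map h [0..<m] = i # As @ c # Bs \<and> type_A a S i \<and>
      (\<forall>x\<in>set As. type_A a S x \<or> type_B a S x) \<and>
      (type_C a S c \<and> (\<forall>j\<in>{1..a c}. contributes_one_of S (c, j) {YL (c, j), T (c, j)})) \<and>
      (\<forall>x\<in>set Bs. type_B a S x))"
    unfolding form1_def by (simp only: conj_assoc)
  also have "\<dots> \<longleftrightarrow> (\<exists>q>0. segment_form a S h m q)"
    unfolding list_split_iff[of _ "type_A a S" _ "\<lambda>c. type_C a S c \<and>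
      (\<forall>j\<in>{1..a c}. contributes_one_of S (c, j) {YL (c, j), T (c, j)})"] segment_form_def
    by (intro ex_cong1) auto
  finally show ?thesis .
qed

lemma form2_map_iff: "form2 a S (map h [0..<m]) \<longleftrightarrow> segment_form a S h m 0"
proof (cases m)
  case (Suc m')
  have "map h [0..<m] = h 0 # map h [1..<m]"
    using Suc by (simp add: upt_conv_Cons del: upt_Suc)
  then have "form2 a S (map h [0..<m]) \<longleftrightarrow> type_C a S (h 0) \<and>
      (\<forall>j\<in>{1..a (h 0)}. contributes_one_of S (h 0, j) {ZE (h 0, j), T (h 0, j)}) \<and>
      (\<forall>x\<in>set (map h [1..<m]). type_B a S x)"
    by (simp add: form2_def)
  then show ?thesis
    unfolding segment_form_def using Suc by (auto simp: Suc_le_eq)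
qed (simp add: form2_def segment_form_def)

text \<open>For \<open>i = j\<close> the length is \<open>n\<close> and not 0, so a single vertex
  variable yields one full turn.\<close>

lemma clockwise_conv_map:
  assumes "i \<in> {1..n}" "j \<in> {1..n}"
  defines "L \<equiv> clockwise n i j"
  shows "L = map (\<lambda>k. (nxt n ^^ k) i) [0..<length L]" "0 < length L" "length L \<le> n"
    "(nxt n ^^ length L) i = j"
proof -
  have "L = map (\<lambda>k. (nxt n ^^ k) i) [0..<length L] \<and> 0 < length L \<and> length L \<le> n \<and>
    (nxt n ^^ length L) i = j"
  proof (cases "i < j")
    case True
    have "L = map (\<lambda>k. (nxt n ^^ k) i) [0..<length L]"
      using True assms by (intro nth_equalityI) (auto simp: clockwise_def funpow_nxt)
    then show ?thesis
      using True assms by (auto simp: clockwise_def funpow_nxt)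
  next
    case False
    have len: "length L = n + j - i"
      using False assms by (auto simp: clockwise_def)
    have "L = map (\<lambda>k. (nxt n ^^ k) i) [0..<length L]"
    proof (rule nth_equalityI)
      fix k assume k: "k < length L"
      show "L ! k = map (\<lambda>k. (nxt n ^^ k) i) [0..<length L] ! k"
      proof (cases "k < Suc n - i")
        case True
        then show ?thesis
          using k False assms by (auto simp: clockwise_def nth_append funpow_nxt simp del: upt_Suc)
      next
        case c: False
        \<comment> \<open>The position has wrapped past \<open>n\<close>; here \<open>k\<close> is
          at least \<open>Suc n - i\<close>, so the truncated subtraction loses nothing.\<close>
        have "(i - 1 + k) mod n = (i + k - Suc n + n) mod n"
          using c assms(1) by (intro arg_cong[where f = "\<lambda>x. x mod n"]) auto
        also have "\<dots> = (i + k - Suc n) mod n"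
          by (rule mod_add_self2)
        also have "\<dots> = i + k - Suc n"
          using k len False assms(1,2) c by (intro mod_less) auto
        finally show ?thesis
          using k c len False assms by (auto simp: clockwise_def nth_append funpow_nxt simp del: upt_Suc)
      qed
    qed simp
    moreover have "(i - 1 + (n + j - i)) mod n = (j - 1 + n) mod n"
      using False assms(1,2) by (intro arg_cong[where f = "\<lambda>x. x mod n"]) auto
    then have "(nxt n ^^ length L) i = j"
      unfolding funpow_nxt[OF assms(1)] len using assms(2) mod_add_self2[of "j - 1" n] by auto
    ultimately show ?thesis
      using False assms(1,2) len by auto
  qed
  then show "L = map (\<lambda>k. (nxt n ^^ k) i) [0..<length L]" "0 < length L" "length L \<le> n"
    "(nxt n ^^ length L) i = j"
    by blast+
qed

section \<open>Segments as consecutive blocks of one full turn\<close>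

context
  fixes n :: nat and idx :: "nat list"
  assumes idx: "sorted_wrt (<) idx" "set idx \<subseteq> {1..n}" "idx \<noteq> []"
begin

abbreviation (input) segment :: "nat \<Rightarrow> nat list" where
  "segment t \<equiv> clockwise n (idx ! t) (idx ! ((t + 1) mod length idx))"

lemma idx_less: "s < t \<Longrightarrow> t < length idx \<Longrightarrow> idx ! s < idx ! t"
  using idx(1) by (simp add: sorted_wrt_iff_nth_less)

lemma idx_le: "s \<le> t \<Longrightarrow> t < length idx \<Longrightarrow> idx ! s \<le> idx ! t"
  using idx_less by (cases "s = t") (auto intro: less_imp_le)

lemma idx_in: "t < length idx \<Longrightarrow> idx ! t \<in> {1..n}"
  using idx(2) by (meson nth_mem subsetD)

lemma segment_eq:
  assumes "t < length idx"
  shows "segment t = (if Suc t < length idx then [idx ! t..<idx ! Suc t] else [idx ! t..<Suc n] @ [1..<idx ! 0])"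
proof (cases "Suc t < length idx")
  case True
  then show ?thesis
    using idx_less[of t "Suc t"] by (simp add: clockwise_def)
next
  case False
  then have "Suc t = length idx"
    using assms by simp
  then show ?thesis
    using idx_le[of 0 t] assms by (simp add: clockwise_def del: upt_Suc)
qed

lemma concat_segments_prefix:
  "m < length idx \<Longrightarrow> concat (map segment [0..<m]) = [idx ! 0..<idx ! m]"
proof (induction m)
  case (Suc m)
  then have "segment m = [idx ! m..<idx ! Suc m]"
    using segment_eq[of m] by simp
  moreover have "[idx ! 0..<idx ! Suc m] = [idx ! 0..<idx ! m] @ [idx ! m..<idx ! Suc m]"
    using upt_add_eq_append[of "idx ! 0" "idx ! m" "idx ! Suc m - idx ! m"] Suc.prems
      idx_le[of 0 m] idx_le[of m "Suc m"] by simp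
  ultimately show ?case
    using Suc by simp
qed simp

text \<open>The right-hand side lists each multi-edge exactly once, which turns sums over segments
  into sums over all multi-edges.\<close>

lemma concat_segments: "concat (map segment [0..<length idx]) = [idx ! 0..<Suc n] @ [1..<idx ! 0]"
proof -
  obtain m where m: "length idx = Suc m"
    using idx(3) by (cases idx) auto
  have "segment m = [idx ! m..<Suc n] @ [1..<idx ! 0]"
    using segment_eq[of m] m by simp
  moreover have "[idx ! 0..<Suc n] = [idx ! 0..<idx ! m] @ [idx ! m..<Suc n]"
    using upt_add_eq_append[of "idx ! 0" "idx ! m" "Suc n - idx ! m"]
      idx_le[of 0 m] idx_in[of m] m by (simp del: upt_Suc)
  ultimately show ?thesis
    using concat_segments_prefix[of m] m by (simp del: upt_Suc add: upt_Suc_append)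
qed

text \<open>Integer values allow for negative excesses. The constant 1 as \<open>f\<close> shows
  that the lengths of the segments add up to \<open>n\<close>.\<close>

lemma sum_segments: "(\<Sum>t<length idx. sum_list (map f (segment t))) = (\<Sum>x=1..n. f x :: int)"
proof -
  have concat: "sum_list (map f (concat xss)) = (\<Sum>xs\<leftarrow>xss. sum_list (map f xs))" for xss
    by (induction xss) simp_all
  have "(\<Sum>t<length idx. sum_list (map f (segment t))) =
      sum_list (map f (concat (map segment [0..<length idx])))"
    using concat by (simp add: o_def interv_sum_list_conv_sum_set_nat atLeast0LessThan)
  also have "\<dots> = (\<Sum>x\<in>{idx ! 0..<Suc n}. f x) + (\<Sum>x\<in>{1..<idx ! 0}. f x)"
    unfolding concat_segments by (simp add: interv_sum_list_conv_sum_set_nat del: upt_Suc)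
  also have "\<dots> = (\<Sum>x\<in>{1..<Suc n}. f x)"
    using sum.atLeastLessThan_concat[of 1 "idx ! 0" "Suc n" f] idx_in[of 0] idx(3) by simp
  finally show ?thesis
    by (simp add: atLeastLessThanSuc_atLeastAtMost)
qed

lemma segments_cover:
  assumes "x \<in> {1..n}"
  shows "\<exists>t<length idx. x \<in> set (segment t)"
proof -
  have "x \<in> set (concat (map segment [0..<length idx]))"
    unfolding concat_segments using assms by auto
  then show ?thesis
    by auto
qed

text \<open>Strict sorting leaves no index between neighbours, and for the wrapping segment none
  after the last or before the first.\<close>

lemma segment_interior:
  assumes "t < length idx" "x \<in> set (segment t)" "x \<in> set idx"
  shows "x = idx ! t"
proof -
  obtain s where s: "s < length idx" "x = idx ! s"
    using assms(3) by (auto simp: in_set_conv_nth)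
  have "\<not> s < t"
    using idx_less[of s t] idx_le[of 0 s] s assms segment_eq[OF assms(1)] by (auto split: if_splits)
  moreover have "\<not> t < s"
  proof
    assume "t < s"
    then have "idx ! Suc t \<le> idx ! s" "Suc t < length idx"
      using idx_le[of "Suc t" s] s by auto
    then show False
      using s assms segment_eq[OF assms(1)] by auto
  qed
  ultimately show ?thesis
    using s by simp
qed

end

section \<open>Segments of a set that avoids all leading monomials\<close>

context
  fixes n :: nat and a :: "nat \<Rightarrow> nat" and S :: "var set"
  assumes n: "n \<ge> 3"
    and free: "edge_free n a S" "parallel_free n a S" "chain_free n a S" "cycle_free n a S"
begin

text \<open>The source depends on the length: a fundamental binomial rules out \<open>l = 1\<close>,
  zigzags cover the lengths in between, and for \<open>l = n\<close>, where the walk closes and is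
  no longer a path, full cycles take over.\<close>

lemma bare_after_YR:
  assumes w: "w \<in> {1..n}" and l: "0 < l" "l \<le> n" and YR: "has_YR a S w"
    and ZV: "ZV ((nxt n ^^ l) w) \<in> S"
  shows "\<exists>k. 0 < k \<and> k < l \<and> bare a S ((nxt n ^^ k) w)"
proof -
  consider "l = 1" | "l \<in> {2..<n}" | "l = n"
    using l by fastforce
  then show ?thesis
  proof cases
    case 1
    then have False
      using free(1) w YR ZV by (auto simp: edge_free_def has_YR_def edges_def)
    then show ?thesis ..
  next
    case 2
    then show ?thesis
      using free(3) w YR ZV unfolding chain_free_def by (meson greaterThanLessThan_iff)
  next
    case 3
    obtain i where i: "i \<in> {1..n}" "bare a S i"
      using free(4) w YR by (auto simp: cycle_free_def)
    then obtain k where k: "k < n" "(nxt n ^^ k) w = i"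
      using funpow_nxt_surj[OF w] by blast
    moreover have "k \<noteq> 0"
      using YR i(2) k(2) by (cases k) (auto simp: has_YR_def bare_def)
    ultimately show ?thesis
      using i 3 by auto
  qed
qed

lemma paired_cases:
  assumes "paired a S i"
  shows "has_YR a S i \<or> has_YL a S i" "\<not> bare a S i"
  using assms by (auto simp: paired_def doubled_def has_YR_def has_YL_def bare_def)

lemma no_YL_at_vertex_variable:
  assumes "u \<in> {1..n}" "ZV u \<in> S"
  shows "\<not> has_YL a S u"
  using free(1) assms by (auto simp: edge_free_def has_YL_def edges_def)

text \<open>If all were paired, the first would have \<open>YR\<close>, its \<open>YL\<close> being
  excluded by the vertex variable at \<open>u\<close>. Then some position would be bare, which a
  paired multi-edge never is.\<close>

lemma exists_unpaired:
  assumes u: "u \<in> {1..n}" "ZV u \<in> S" and m: "0 < m" "m \<le> n" and ZV: "ZV ((nxt n ^^ m) u) \<in> S"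
  shows "\<exists>q<m. \<not> paired a S ((nxt n ^^ q) u)"
proof (rule ccontr)
  assume "\<not> (\<exists>q<m. \<not> paired a S ((nxt n ^^ q) u))"
  then have paired: "paired a S ((nxt n ^^ q) u)" if "q < m" for q
    using that by blast
  have "has_YR a S u"
    using paired_cases(1) paired[of 0] m(1) no_YL_at_vertex_variable[OF u] by auto
  then obtain k where "k < m" "bare a S ((nxt n ^^ k) u)"
    using bare_after_YR[OF u(1) m _ ZV] by blast
  then show False
    using paired paired_cases(2) by blast
qed

text \<open>Types A and B are not bare, so a \<open>YR\<close> at position r needs q as the bare
  position after it, whence r < q. This leaves only type B behind q, while the vertex variable at
  \<open>u\<close> excludes type B at position 0.\<close>

lemma segment_form_if_types:
  assumes u: "u \<in> {1..n}" "ZV u \<in> S" and m: "0 < m" "m \<le> n" and ZV: "ZV ((nxt n ^^ m) u) \<in> S"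
    and q: "q < m" "type_C a S ((nxt n ^^ q) u)"
    and AB: "\<And>r. r < m \<Longrightarrow> r \<noteq> q \<Longrightarrow> type_A a S ((nxt n ^^ r) u) \<or> type_B a S ((nxt n ^^ r) u)"
  shows "segment_form a S (\<lambda>k. (nxt n ^^ k) u) m q"
proof -
  let ?h = "\<lambda>k. (nxt n ^^ k) u"
  have not_bare: "\<not> bare a S (?h r)" if "r < m" "r \<noteq> q" for r
    using AB[OF that] type_A_properties(3) type_B_properties(3) by blast
  have YR_before: "r < q" if r: "r < m" "has_YR a S (?h r)" for r
  proof -
    have "(nxt n ^^ (m - r)) (?h r) = ?h m"
      using funpow_add[of "m - r" r "nxt n"] r(1) by simp
    then have "\<exists>k. 0 < k \<and> k < m - r \<and> bare a S ((nxt n ^^ k) (?h r))"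
      using m r ZV by (intro bare_after_YR[OF funpow_nxt_in[OF u(1)]]) auto
    then obtain k where "0 < k" "k + r < m" "bare a S (?h (k + r))"
      by (auto simp: funpow_add less_diff_conv)
    with not_bare show "r < q"
      by fastforce
  qed
  have B: "type_B a S (?h r)" if "q < r" "r < m" for r
    using AB[of r] YR_before[of r] type_A_properties(1)[of a S "?h r"] that by auto
  have C: "card (S \<inter> edge_vars (?h q, j)) = 1" if "j \<in> {1..a (?h q)}" for j
    using q(2) that by (simp add: type_C_def contributes_one_of_edge_vars)
  show ?thesis
  proof (cases "q = 0")
    case True
    \<comment> \<open>A \<open>YR\<close> at position 0 would have to come before
      \<open>q = 0\<close>.\<close>
    have "\<not> has_YL a S u" "\<not> has_YR a S u"
      using no_YL_at_vertex_variable[OF u] YR_before[of 0] m(1) True by auto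
    then have "contributes_one_of S (u, j) {ZE (u, j), T (u, j)}" if "j \<in> {1..a u}" for j
      using C[of j] True that
      by (intro contributes_one_of_if_card(1)) (auto simp: has_YL_def has_YR_def)
    then show ?thesis
      using q B True by (simp add: segment_form_def)
  next
    case False
    have A: "type_A a S (?h 0)"
      using AB[of 0] False m(1) no_YL_at_vertex_variable[OF u] type_B_properties(1) by auto
    then have "has_YR a S u"
      using type_A_properties(1) by simp
    then obtain k where k: "0 < k" "k < m" "bare a S (?h k)"
      using bare_after_YR[OF u(1) m _ ZV] by blast
    then have "bare a S (?h q)"
      using not_bare by metis
    then have "contributes_one_of S (?h q, j) {YL (?h q, j), T (?h q, j)}" if "j \<in> {1..a (?h q)}" for j
      using C[OF that] that by (intro contributes_one_of_if_card(2)) (auto simp: bare_def)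
    then show ?thesis
      using q B A AB False by (simp add: segment_form_def)
  qed
qed

text \<open>The edges alone would need an excess of one in every multi-edge, so all are paired. But
  some multi-edge lacks \<open>YL\<close>, hence has \<open>YR\<close>, and then full cycles require
  a bare one.\<close>

lemma vertex_variables_nonempty:
  assumes "S \<inter> ZV ` {1..n} = {}" "S \<subseteq> vars n a" "card S = n + (\<Sum>i=1..n. a i)"
  shows False
proof -
  have "(\<Sum>i=1..n. contribution a S i) = (\<Sum>i=1..n. a i + 1)"
    using card_eq_contributions[OF assms(2)] assms(1,3) by (simp add: sum.distrib sum_Suc)
  moreover have "contribution a S i \<le> a i + 1" if "i \<in> {1..n}" for i
    using contribution_le[OF free(1,2) that] by (auto simp: of_bool_def split: if_splits)
  ultimately have "contribution a S i = a i + 1" if "i \<in> {1..n}" for i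
    using sum_mono_inv[of "contribution a S" "{1..n}" "\<lambda>i. a i + 1" i] that by simp
  then have paired: "paired a S i" if "i \<in> {1..n}" for i
    using contribution_le[OF free(1,2) that] that by (auto simp: of_bool_def split: if_splits)
  obtain i where i: "i \<in> {1..n}" "\<not> has_YL a S i"
    using free(4) by (auto simp: cycle_free_def)
  then have "has_YR a S i"
    using paired paired_cases(1) by blast
  then obtain i' where "i' \<in> {1..n}" "bare a S i'"
    using free(4) i by (auto simp: cycle_free_def)
  then show False
    using paired paired_cases(2) by blast
qed

end

text \<open>The upper bounds on the excesses of the segments add up to exactly the excess that the
  cardinality of \<open>S\<close> demands, so each of them is attained.\<close>

lemma segment_forms_if_facet:
  assumes n: "n \<ge> 3"
    and free: "edge_free n a S" "parallel_free n a S" "chain_free n a S" "cycle_free n a S"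
    and S: "S \<subseteq> vars n a" "card S = n + (\<Sum>i=1..n. a i)" "S \<inter> ZV ` {1..n} = ZV ` set idx"
    and idx: "sorted_wrt (<) idx" "set idx \<subseteq> {1..n}" "idx \<noteq> []" and t: "t < length idx"
  defines "m \<equiv> \<lambda>t. length (segment n idx t)"
  shows "\<exists>q. segment_form a S (\<lambda>k. (nxt n ^^ k) (idx ! t)) (m t) q"
proof -
  let ?h = "\<lambda>t k. (nxt n ^^ k) (idx ! t)"
  \<comment> \<open>The excess over one variable per edge; an integer, since a multi-edge might fall
    short before tightness is known.\<close>
  define d where "d x = int (contribution a S x) - int (a x)" for x
  have ix: "idx ! t \<in> {1..n}" "idx ! ((t + 1) mod length idx) \<in> {1..n}" if "t < length idx" for t
    using idx that by (meson mod_less_divisor nth_mem subsetD length_greater_0_conv)+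
  have ZV: "ZV x \<in> S" if "x \<in> set idx" for x
    using S(3) that by blast
  have seg: "segment n idx t = map (?h t) [0..<m t]" "0 < m t" "m t \<le> n" "ZV (?h t (m t)) \<in> S"
    if "t < length idx" for t
    using clockwise_conv_map[OF ix[OF that]] that idx(3) by (auto simp: m_def intro!: ZV)
  have h_in: "?h t r \<in> {1..n}" if "t < length idx" for t r
    using funpow_nxt_in[OF ix(1)[OF that]] .
  have sum_list_seg: "sum_list (map f (segment n idx t)) = (\<Sum>r<m t. f (?h t r))"
    if "t < length idx" for f :: "nat \<Rightarrow> int" and t
    unfolding seg(1)[OF that]
    by (simp add: o_def interv_sum_list_conv_sum_set_nat atLeast0LessThan)
  have d_le: "d (?h t r) \<le> of_bool (paired a S (?h t r))" if "t < length idx" for t r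
    using contribution_le[OF free(1,2) h_in[OF that, of r]]
    by (auto simp: d_def of_bool_def split: if_splits)
  have unpaired: "\<exists>q<m t. \<not> paired a S (?h t q)" if "t < length idx" for t
    using exists_unpaired[OF n free ix(1)[OF that] _ seg(2-4)[OF that]] ZV that by simp
  have le_one: "d (?h t r) \<le> of_bool (r \<noteq> q)" if "t < length idx" "\<not> paired a S (?h t q)" for t r q
    using d_le[OF that(1), of r] that(2) by (auto simp: of_bool_def split: if_splits)
  have sum_one: "(\<Sum>r<m t. of_bool (r \<noteq> q)) = int (m t) - 1" if "q < m t" for t q
  proof -
    have "(\<Sum>r<m t. of_bool (r \<noteq> q) :: int) = (\<Sum>r<m t. 1 - of_bool (r = q))"
      by (intro sum.cong) auto
    also have "\<dots> = int (m t) - 1"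
      using that by (simp add: sum_subtractf of_bool_def)
    finally show ?thesis .
  qed
  have sum_le: "(\<Sum>r<m t. d (?h t r)) \<le> int (m t) - 1" if "t < length idx" for t
  proof -
    obtain q where q: "q < m t" "\<not> paired a S (?h t q)"
      using unpaired[OF \<open>t < length idx\<close>] by blast
    have "(\<Sum>r<m t. d (?h t r)) \<le> (\<Sum>r<m t. of_bool (r \<noteq> q))"
      using le_one[OF that q(2)] by (rule sum_mono)
    then show ?thesis
      using sum_one[OF q(1)] by simp
  qed
  have "(\<Sum>t<length idx. \<Sum>r<m t. d (?h t r)) = (\<Sum>x=1..n. d x)"
    using sum_segments[OF idx, of d] sum_list_seg by simp
  \<comment> \<open>Of the \<open>n\<close> variables beyond one per edge, \<open>length idx\<close>
    are vertex variables.\<close>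
  also have "\<dots> = int n - int (length idx)"
  proof -
    have "card (ZV ` set idx) = length idx"
      using idx(1) by (subst card_image) (auto simp: inj_on_def distinct_card strict_sorted_iff)
    then have "int n + (\<Sum>i=1..n. int (a i)) = int (length idx) + (\<Sum>i=1..n. int (contribution a S i))"
      using card_eq_contributions[OF S(1)] S(2,3) by (metis of_nat_add of_nat_sum)
    then show ?thesis
      by (simp add: d_def sum_subtractf)
  qed
  also have "\<dots> = (\<Sum>t<length idx. int (m t) - 1)"
  proof -
    have "(\<Sum>t<length idx. int (m t)) = (\<Sum>x=1..n. 1)"
      using sum_segments[OF idx, of "\<lambda>_. 1"] by (simp add: sum_list_triv m_def)
    then show ?thesis
      by (simp add: sum_subtractf)
  qed
  \<comment> \<open>Tightness passes from the total to each segment, and below from the segment to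
    each of its multi-edges.\<close>
  finally have "(\<Sum>r<m t. d (?h t r)) = int (m t) - 1"
    using sum_mono_inv[of "\<lambda>t. \<Sum>r<m t. d (?h t r)" "{..<length idx}" "\<lambda>t. int (m t) - 1" t]
      sum_le t by simp
  moreover obtain q where q: "q < m t" "\<not> paired a S (?h t q)"
    using unpaired[OF t] by blast
  ultimately have "d (?h t r) = of_bool (r \<noteq> q)" if "r < m t" for r
    using sum_mono_inv[of "\<lambda>r. d (?h t r)" "{..<m t}" "\<lambda>r. of_bool (r \<noteq> q)" r]
      le_one[OF t q(2)] sum_one[OF q(1)] that by simp
  note d = this
  have "type_C a S (?h t q)"
    using d[OF q(1)] q(2) by (intro type_C_if_tight[OF free(1,2) h_in[OF t]]) (auto simp: d_def)
  moreover have "type_A a S (?h t r) \<or> type_B a S (?h t r)" if "r < m t" "r \<noteq> q" for r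
  proof (rule type_A_or_B_if_tight[OF free(1,2) h_in[OF t]])
    show "contribution a S (?h t r) = a (?h t r) + 1"
      using d[OF that(1)] that(2) by (simp add: d_def)
    show "paired a S (?h t r)"
      using d[OF that(1)] that(2) d_le[OF t, of r] by (auto simp: of_bool_def split: if_splits)
  qed
  ultimately have "segment_form a S (?h t) (m t) q"
    using ZV t q(1) seg(2-4)[OF t] by (intro segment_form_if_types[OF n free ix(1)[OF t]]) auto
  then show ?thesis ..
qed

text \<open>Each segment has \<open>YR\<close> only before its position \<open>q t\<close>, which is
  then bare, and vertex variables in \<open>S\<close> belong only to starts of segments. So no
  forward chain from a \<open>YR\<close> reaches a vertex variable unblocked.\<close>

lemma facet_if_segment_forms:
  assumes n: "n \<ge> 3" and S: "S \<subseteq> vars n a" "S \<inter> ZV ` {1..n} = ZV ` set idx"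
    and idx: "sorted_wrt (<) idx" "set idx \<subseteq> {1..n}" "idx \<noteq> []"
    and form: "\<And>t. t < length idx \<Longrightarrow>
      \<exists>q. segment_form a S (\<lambda>k. (nxt n ^^ k) (idx ! t)) (length (segment n idx t)) q"
  shows "card S = n + (\<Sum>i=1..n. a i)"
    and "edge_free n a S" "parallel_free n a S" "chain_free n a S" "cycle_free n a S"
proof -
  let ?h = "\<lambda>t k. (nxt n ^^ k) (idx ! t)"
  define m where "m t = length (segment n idx t)" for t
  have ix: "idx ! t \<in> {1..n}" "idx ! ((t + 1) mod length idx) \<in> {1..n}" if "t < length idx" for t
    using idx that by (meson mod_less_divisor nth_mem subsetD length_greater_0_conv)+
  have seg: "segment n idx t = map (?h t) [0..<m t]" "0 < m t" "m t \<le> n"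
    if "t < length idx" for t
    using clockwise_conv_map[OF ix[OF that]] by (simp_all add: m_def)
  obtain q where q: "\<And>t. t < length idx \<Longrightarrow> segment_form a S (?h t) (m t) (q t)"
    using form unfolding m_def by metis
  have q_less: "q t < m t" if "t < length idx" for t
    using q[OF that] by (simp add: segment_form_def)
  have cover: "\<exists>t<length idx. \<exists>r<m t. ?h t r = x" if x: "x \<in> {1..n}" for x
  proof -
    obtain t where t: "t < length idx" "x \<in> set (segment n idx t)"
      using segments_cover[OF idx x] by blast
    then show ?thesis
      using seg(1)[OF t(1)] by force
  qed
  have interior: "r = 0" if "t < length idx" "r < m t" "ZV (?h t r) \<in> S" for t r
  proof -
    have "?h t r \<in> set (segment n idx t)"
      using seg(1)[OF that(1)] that(2) by force
    moreover have "?h t r \<in> set idx"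
      using S(2) that(3) funpow_nxt_in[OF ix(1)[OF that(1)], of r] by blast
    ultimately have "?h t r = ?h t 0"
      using segment_interior[OF idx that(1)] by simp
    \<comment> \<open>A segment has at most \<open>n\<close> positions, so equal vertices mean equal
      positions.\<close>
    then show "r = 0"
      using funpow_nxt_eq_iff[OF ix(1)[OF that(1)], of r 0] that(2) seg(3)[OF that(1)] n by simp
  qed
  \<comment> \<open>The two shapes of a type C multi-edge are named so that case analyses treat them
    as atoms.\<close>
  define bareC where "bareC x \<longleftrightarrow> (\<forall>j\<in>{1..a x}. contributes_one_of S (x, j) {YL (x, j), T (x, j)})" for x
  define ztC where "ztC x \<longleftrightarrow> (\<forall>j\<in>{1..a x}. contributes_one_of S (x, j) {ZE (x, j), T (x, j)})" for x
  have bareC: "bare a S x" if "bareC x" for x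
    using that by (auto simp: bareC_def bare_def contributes_one_of_simps)
  have ztC: "\<not> has_YR a S x" "\<not> has_YL a S x" if "ztC x" for x
    using that by (auto simp: ztC_def has_YR_def has_YL_def contributes_one_of_simps)
  have types: "type_A a S x \<or> type_B a S x \<or> bareC x \<or> ztC x" if x: "x \<in> {1..n}" for x
  proof -
    obtain t r where tr: "t < length idx" "r < m t" "?h t r = x"
      using cover[OF x] by blast
    have "type_A a S (?h t r) \<or> type_B a S (?h t r) \<or> bareC (?h t r) \<or> ztC (?h t r)"
      using q[OF tr(1)] tr(2) unfolding segment_form_def bareC_def[symmetric] ztC_def[symmetric]
      by (cases r "q t" rule: linorder_cases; cases "r = 0") (auto split: if_splits)
    with tr(3) show ?thesis by simp
  qed
  have bare_after: "\<exists>k. r < k \<and> k < m t \<and> bare a S (?h t k)"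
    if "t < length idx" "r < m t" "has_YR a S (?h t r)" for t r
  proof -
    note form = q[OF that(1), unfolded segment_form_def, folded bareC_def ztC_def]
    have "\<not> type_B a S (?h t r)" "\<not> bareC (?h t r)" "\<not> ztC (?h t r)"
      using that(3) type_B_properties(2) bareC ztC(1) by (auto simp: has_YR_def bare_def)
    then have "r < q t"
      using form that(2) by (cases r "q t" rule: linorder_cases) (auto split: if_splits)
    moreover from this have "bare a S (?h t (q t))"
      using form bareC by (auto split: if_splits)
    ultimately show ?thesis
      using q_less[OF that(1)] by blast
  qed
  have no_YL_start: "\<not> has_YL a S (idx ! t)" if "t < length idx" for t
  proof -
    note form = q[OF that(1), unfolded segment_form_def, folded bareC_def ztC_def]
    show ?thesis
      using form type_A_properties(2)[of a S "idx ! t"] ztC(2)[of "idx ! t"] by (auto split: if_splits)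
  qed
  \<comment> \<open>Stated for every positive \<open>l\<close>: for \<open>l = 1\<close> the range
    of \<open>k\<close> is empty, which excludes a \<open>YR\<close> together with the vertex
    variable at its end.\<close>
  have chain: "\<exists>k\<in>{0<..<l}. bare a S ((nxt n ^^ k) w)"
    if w: "w \<in> {1..n}" and l: "0 < l" and YR: "has_YR a S w" and ZV: "ZV ((nxt n ^^ l) w) \<in> S" for w l
  proof -
    obtain t r where tr: "t < length idx" "r < m t" "?h t r = w"
      using cover[OF w] by blast
    obtain k where k: "r < k" "k < m t" "bare a S (?h t k)"
      using bare_after[OF tr(1,2)] YR tr(3) by blast
    have shift: "(nxt n ^^ s) w = ?h t (s + r)" for s
      by (simp add: funpow_add tr(3)[symmetric])
    \<comment> \<open>A vertex variable strictly inside the segment is impossible, so this one comes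
      no earlier than the segment's end, after the bare multi-edge.\<close>
    have "m t \<le> l + r"
      using interior[OF tr(1), of "l + r"] l ZV unfolding shift by fastforce
    then show ?thesis
      using k by (intro bexI[of _ "k - r"]) (auto simp: shift)
  qed
  show "chain_free n a S"
    unfolding chain_free_def using chain by auto
  show "cycle_free n a S"
    unfolding cycle_free_def
  proof (intro conjI impI)
    assume "\<exists>i\<in>{1..n}. has_YR a S i"
    then obtain i where i: "i \<in> {1..n}" "has_YR a S i" by blast
    then obtain t r where tr: "t < length idx" "r < m t" "?h t r = i"
      using cover by blast
    then obtain k where "bare a S (?h t k)"
      using bare_after i(2) by blast
    then show "\<exists>i\<in>{1..n}. bare a S i"
      using funpow_nxt_in[OF ix(1)[OF tr(1)]] by blast
  next
    show "\<exists>i\<in>{1..n}. \<not> has_YL a S i"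
      using no_YL_start[of 0] ix(1)[of 0] idx(3) by blast
  qed
  show "edge_free n a S"
    unfolding edge_free_def
  proof
    fix e assume "e \<in> edges n a"
    then obtain i j where e: "e = (i, j)" "i \<in> {1..n}" "j \<in> {1..a i}"
      by (auto simp: edges_def)
    \<comment> \<open>Constraints within one edge follow from the type of its multi-edge; those with
      vertex variables depend on its place in the segments.\<close>
    have local: "\<not> {YR e, YL e} \<subseteq> S \<and> \<not> {YR e, T e} \<subseteq> S \<and> \<not> {YL e, T e} \<subseteq> S \<and> \<not> {T e, ZE e} \<subseteq> S"
      using types[OF e(2)]
    proof (elim disjE)
      assume "type_A a S i"
      then obtain j0 where "YR (i, j0) \<in> S \<and> ZE (i, j0) \<in> S \<and> YL (i, j0) \<notin> S \<and> T (i, j0) \<notin> S"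
        "(j < j0 \<longrightarrow> YR (i, j) \<notin> S \<and> YL (i, j) \<notin> S \<and> (T (i, j) \<in> S \<longleftrightarrow> ZE (i, j) \<notin> S)) \<and>
         (j > j0 \<longrightarrow> ZE (i, j) \<notin> S \<and> YL (i, j) \<notin> S \<and> (T (i, j) \<in> S \<longleftrightarrow> YR (i, j) \<notin> S))"
        using e(3) unfolding type_A_iff by blast
      then show ?thesis
        by (cases j j0 rule: linorder_cases) (auto simp: e(1))
    next
      assume "type_B a S i"
      then obtain j0 where "YL (i, j0) \<in> S \<and> ZE (i, j0) \<in> S \<and> YR (i, j0) \<notin> S \<and> T (i, j0) \<notin> S"
        "(j < j0 \<longrightarrow> YR (i, j) \<notin> S \<and> ZE (i, j) \<notin> S \<and> (T (i, j) \<in> S \<longleftrightarrow> YL (i, j) \<notin> S)) \<and>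
         (j > j0 \<longrightarrow> YR (i, j) \<notin> S \<and> YL (i, j) \<notin> S \<and> (T (i, j) \<in> S \<longleftrightarrow> ZE (i, j) \<notin> S))"
        using e(3) unfolding type_B_iff by blast
      then show ?thesis
        by (cases j j0 rule: linorder_cases) (auto simp: e(1))
    qed (use e in \<open>auto simp: bareC_def ztC_def contributes_one_of_simps\<close>)
    have "\<not> {YR e, ZV (nxt n (fst e))} \<subseteq> S"
    proof
      assume "{YR e, ZV (nxt n (fst e))} \<subseteq> S"
      then have "has_YR a S i" "ZV ((nxt n ^^ 1) i) \<in> S"
        using e by (auto simp: has_YR_def)
      then show False
        using chain[OF e(2), of 1] by simp
    qed
    moreover have "\<not> {YL e, ZV (fst e)} \<subseteq> S"
    proof
      assume YL: "{YL e, ZV (fst e)} \<subseteq> S"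
      then have "i \<in> set idx"
        using S(2) e by auto
      then obtain t where "t < length idx" "i = idx ! t"
        by (auto simp: in_set_conv_nth)
      then show False
        using no_YL_start[of t] YL e by (auto simp: has_YL_def)
    qed
    ultimately show "\<not> {YR e, YL e} \<subseteq> S \<and> \<not> {YR e, T e} \<subseteq> S \<and> \<not> {YL e, T e} \<subseteq> S \<and>
      \<not> {YR e, ZV (nxt n (fst e))} \<subseteq> S \<and> \<not> {YL e, ZV (fst e)} \<subseteq> S \<and> \<not> {T e, ZE e} \<subseteq> S"
      using local by blast
  qed
  show "parallel_free n a S"
    unfolding parallel_free_def
  proof (intro ballI)
    fix i j k assume ijk: "i \<in> {1..n}" "j \<in> {1..a i}" "k \<in> {1..a i}"
    show "(j \<noteq> k \<longrightarrow> \<not> {YR (i, j), YL (i, k)} \<subseteq> S) \<and>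
      (j < k \<longrightarrow> \<not> {YR (i, j), ZE (i, k)} \<subseteq> S \<and> \<not> {YL (i, k), ZE (i, j)} \<subseteq> S)"
      using types[OF ijk(1)]
    proof (elim disjE)
      assume A: "type_A a S i"
      then have "YL (i, k) \<notin> S" if "k \<in> {1..a i}" for k
        using type_A_properties(2) that by (auto simp: has_YL_def)
      moreover have "\<not> (YR (i, j) \<in> S \<and> ZE (i, k) \<in> S)" if "j < k"
        using A ijk that unfolding type_A_iff by (metis less_trans linorder_neqE_nat)
      ultimately show ?thesis
        using ijk by blast
    next
      assume B: "type_B a S i"
      then have "YR (i, k) \<notin> S" if "k \<in> {1..a i}" for k
        using type_B_properties(2) that by (auto simp: has_YR_def)
      moreover have "\<not> (YL (i, k) \<in> S \<and> ZE (i, j) \<in> S)" if "j < k"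
        using B ijk that unfolding type_B_iff by (metis less_trans linorder_neqE_nat)
      ultimately show ?thesis
        using ijk by blast
    qed (use ijk in \<open>auto simp: bareC_def ztC_def contributes_one_of_simps\<close>)
  qed
  show "card S = n + (\<Sum>i=1..n. a i)"
  proof -
    define d where "d x = int (contribution a S x) - int (a x)" for x
    \<comment> \<open>Types A and B have excess 1 and type C has excess 0, and each segment contains
      exactly one multi-edge of type C.\<close>
    have d: "sum_list (map d (segment n idx t)) = int (m t) - 1" if t: "t < length idx" for t
    proof -
      note form = q[OF t, unfolded segment_form_def]
      have "d (?h t r) = 1 - of_bool (r = q t)" if "r < m t" for r
      proof (cases "r = q t")
        case True
        then show ?thesis
          using form contribution_type_C by (simp add: d_def)
      next
        case False
        then have "type_A a S (?h t r) \<or> type_B a S (?h t r)"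
          using form that by (cases r "q t" rule: linorder_cases; cases "r = 0") (auto split: if_splits)
        then have "contribution a S (?h t r) = a (?h t r) + 1"
          using contribution_type_A contribution_type_B by blast
        with False show ?thesis
          by (simp add: d_def)
      qed
      then have "(\<Sum>r<m t. d (?h t r)) = (\<Sum>r<m t. 1 - of_bool (r = q t))"
        by (intro sum.cong) auto
      also have "\<dots> = int (m t) - 1"
        using q_less[OF t] by (simp add: sum_subtractf of_bool_def)
      finally show ?thesis
        unfolding seg(1)[OF t]
        by (simp add: o_def interv_sum_list_conv_sum_set_nat atLeast0LessThan)
    qed
    have "(\<Sum>x=1..n. d x) = (\<Sum>t<length idx. int (m t) - 1)"
      using sum_segments[OF idx, of d] d by simp
    also have "\<dots> = int n - int (length idx)"
      using sum_segments[OF idx, of "\<lambda>_. 1"] by (simp add: sum_list_triv m_def sum_subtractf)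
    finally have "int (\<Sum>i=1..n. contribution a S i) + int (length idx) = int n + int (\<Sum>i=1..n. a i)"
      by (simp add: d_def sum_subtractf)
    moreover have "card (ZV ` set idx) = length idx"
      using idx(1) by (subst card_image) (auto simp: inj_on_def distinct_card strict_sorted_iff)
    ultimately show ?thesis
      using card_eq_contributions[OF S(1)] S(2) by (simp del: of_nat_sum)
  qed
qed

theorem theorem4p2:
  fixes n :: nat and a :: "nat \<Rightarrow> nat" and S :: "var set" and idx :: "nat list"
  assumes "n \<ge> 3"
    and "\<And>i. i \<in> {1..n} \<Longrightarrow> a i \<ge> 1"
    and "S \<subseteq> vars n a"
    and "sorted_wrt (<) idx"
    and "S \<inter> ZV ` {1..n} = ZV ` set idx"
  shows "facet (binomials n a :: 'k::field mpoly set) n a S \<longleftrightarrow>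
    S \<inter> ZV ` {1..n} \<noteq> {} \<and>
    (\<forall>t < length idx.
      let L = clockwise n (idx ! t) (idx ! ((t + 1) mod length idx)) in
      form1 a S L \<or> form2 a S L)"
proof -
  have facet: "facet (binomials n a :: 'k mpoly set) n a S \<longleftrightarrow> card S = n + (\<Sum>i=1..n. a i) \<and>
      edge_free n a S \<and> parallel_free n a S \<and> chain_free n a S \<and> cycle_free n a S"
    using facet_iff[of n a S, where 'k = 'k] assms(1-3) by blast
  have idx_sub: "set idx \<subseteq> {1..n}"
  proof
    fix x assume "x \<in> set idx"
    then have "ZV x \<in> ZV ` {1..n}"
      using assms(5) by blast
    then show "x \<in> {1..n}" by blast
  qed
  show ?thesis
  \<comment> \<open>Without vertex variables the right-hand side fails at once, and the count rules
    out a facet.\<close>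
  proof (cases "idx = []")
    case True
    then show ?thesis
      using facet vertex_variables_nonempty[of n a S] assms by auto
  next
    case False
    have forms: "form1 a S (segment n idx t) \<or> form2 a S (segment n idx t) \<longleftrightarrow>
      (\<exists>q. segment_form a S (\<lambda>k. (nxt n ^^ k) (idx ! t)) (length (segment n idx t)) q)"
      if "t < length idx" for t
    proof -
      have "idx ! t \<in> {1..n}" "idx ! ((t + 1) mod length idx) \<in> {1..n}"
        using idx_sub that by (meson mod_less_divisor nth_mem subsetD order_le_less_trans zero_le)+
      from clockwise_conv_map(1)[OF this] show ?thesis
        using form1_map_iff form2_map_iff by (metis gr0I)
    qed
    have "facet (binomials n a :: 'k mpoly set) n a S \<longleftrightarrow>
      (\<forall>t<length idx. form1 a S (segment n idx t) \<or> form2 a S (segment n idx t))"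
      unfolding facet
      using segment_forms_if_facet[OF assms(1) _ _ _ _ assms(3) _ assms(5,4) idx_sub False]
        facet_if_segment_forms[OF assms(1,3,5,4) idx_sub False] forms by blast
    then show ?thesis
      using False assms(5) by (simp add: Let_def)
  qed
qed

end
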